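(* Let $s$ be a weak composition. Define the edge labeling $\lambda$ of the Hasse diagram of the $s$-Tamari lattice by $\lambda(T,Z)=a$ for every cover relation $T\lessdot_{Tam} Z$, where $(a,b)$ is the unique Tamari tree ascent of $T$ such that $Z$ is the $s$-Tamari rotation of $T$ along $(a,b)$. Then $\lambda$ is an SB-labeling of the $s$-Tamari lattice.
   Context: A weak composition is a sequence $s=(s(1),\dots,s(n))$ of nonnegative integers. An $s$-decreasing tree is a planar rooted tree $T$ whose internal vertices are labeled bijectively by $1,\dots,n$ (leaves unlabeled), such that internal vertex $i$ has exactly $s(i)+1$ children, indexed $0,\dots,s(i)$ from left to right, and every labeled descendant of $i$ has label smaller than $i$. $T^i_j$ denotes the full subtree rooted at the $j$-th child of $i$. For $1\le x<y\le n$ the cardinality $\#_T(y,x)$ is: $0$ if $x$ is left of $y$ in $T$ or $x\in T^y_0$; $i$ if $x\in T^y_i$ with $0<i<s(y)$; $s(y)$ if $x\in T^y_{s(y)}$ or $x$ is right of $y$. $\mathrm{inv}(T)$ is the multiset of pairs $(y,x)$, $x<y$, with multiplicity $\#_T(y,x)$. For multisets of such pairs: $I\subseteq J$ is multiplicity-wise inclusion; $I+(b,a)$ increases the multiplicity of $(b,a)$ by one (capped at $s(b)$); $I$ is transitive if for all $a<b<c$ with $\#_I(c,b)=i$, either $\#_I(b,a)=0$ or $\#_I(c,a)\ge i$; $I^{tc}$ is the smallest transitive multiset containing $I$. The $s$-weak order on $s$-decreasing trees is $T\preceq Z$ iff $\mathrm{inv}(T)\subseteq\mathrm{inv}(Z)$;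 it is a lattice. An $s$-Tamari tree is an $s$-decreasing tree $T$ with $\#_T(c,a)\le\#_T(c,b)$ for all $a<b<c$. The $s$-Tamari trees form a sublattice of $s$-weak order, the $s$-Tamari lattice (order $\preceq_{Tam}$, covers $\lessdot_{Tam}$, joins equal to those in $s$-weak order). For $a<b$, $(a,b)$ is a Tamari tree ascent of an $s$-Tamari tree $T$ if $a$ is a child of $b$ and $\#_T(b,a)<s(b)$. For such $(a,b)$, $(\mathrm{inv}(T)+(b,a))^{tc}=\mathrm{inv}(Z)$ for a unique $s$-Tamari tree $Z$, the $s$-Tamari rotation of $T$ along $(a,b)$; it is known that $T\lessdot_{Tam}Z$ iff $Z$ is the $s$-Tamari rotation of $T$ along a unique Tamari tree ascent of $T$. An SB-labeling of a finite lattice $L$ is an edge labeling $\lambda$ such that for all $u,v,w$ with $v\ne w$ both covering $u$: (i) $\lambda(u,v)\ne\lambda(u,w)$; (ii) every saturated chain from $u$ to $v\vee w$ uses both labels $\lambda(u,v),\lambda(u,w)$ a positive number of times; (iii) no such chain uses any other label. *)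

theory Defs
  imports "HOL-Algebra.Lattice" "HOL-Library.Multiset"
begin

(* A weak composition (s(1),...,s(n)) is given by its length n :: nat together with
   s :: nat => nat; the values of s outside {1..n} are never used. *)

section \<open>s-decreasing trees\<close>

datatype ltree = Leaf | Node nat "ltree list"

fun labels :: "ltree \<Rightarrow> nat list" where
  "labels Leaf = []"
| "labels (Node i ts) = i # concat (map labels ts)"

fun subtrees :: "ltree \<Rightarrow> ltree set" where
  "subtrees Leaf = {Leaf}"
| "subtrees (Node i ts) = insert (Node i ts) (\<Union>t\<in>set ts. subtrees t)"

definition s_decreasing_tree :: "nat \<Rightarrow> (nat \<Rightarrow> nat) \<Rightarrow> ltree \<Rightarrow> bool" where
  "s_decreasing_tree n s T \<longleftrightarrow>
     distinct (labels T) \<and> set (labels T) = {1..n} \<and>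
     (\<forall>i ts. Node i ts \<in> subtrees T \<longrightarrow>
        length ts = s i + 1 \<and> (\<forall>t\<in>set ts. \<forall>x\<in>set (labels t). x < i))"

(* x lies in the full subtree rooted at the j-th child of the vertex y of T,
   children being counted from 0 *)
definition in_child_subtree :: "ltree \<Rightarrow> nat \<Rightarrow> nat \<Rightarrow> nat \<Rightarrow> bool" where
  "in_child_subtree T y j x \<longleftrightarrow>
     (\<exists>ts. Node y ts \<in> subtrees T \<and> j < length ts \<and> x \<in> set (labels (ts ! j)))"

definition left_of :: "ltree \<Rightarrow> nat \<Rightarrow> nat \<Rightarrow> bool" where
  "left_of T x y \<longleftrightarrow>
     (\<exists>z i j. i < j \<and> in_child_subtree T z i x \<and> in_child_subtree T z j y)"

definition child_of :: "ltree \<Rightarrow> nat \<Rightarrow> nat \<Rightarrow> bool" where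
  "child_of T a b \<longleftrightarrow> (\<exists>ts us. Node b ts \<in> subtrees T \<and> Node a us \<in> set ts)"

section \<open>Inversions\<close>

(* For an s-decreasing tree and x < y, the last case is exactly that x lies in the subtree of the
   s(y)-th child of y or x is right of y, since y is not a descendant of x. *)
definition tree_card :: "(nat \<Rightarrow> nat) \<Rightarrow> ltree \<Rightarrow> nat \<Rightarrow> nat \<Rightarrow> nat" where
  "tree_card s T y x =
     (if left_of T x y \<or> in_child_subtree T y 0 x then 0
      else if \<exists>i. 0 < i \<and> i < s y \<and> in_child_subtree T y i x
        then (THE i. 0 < i \<and> i < s y \<and> in_child_subtree T y i x)
      else s y)"

definition inversion_pairs :: "nat \<Rightarrow> (nat \<times> nat) set" where
  "inversion_pairs n = {(y, x). 1 \<le> x \<and> x < y \<and> y \<le> n}"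

definition tree_inv :: "nat \<Rightarrow> (nat \<Rightarrow> nat) \<Rightarrow> ltree \<Rightarrow> (nat \<times> nat) multiset" where
  "tree_inv n s T = (\<Sum>(y, x)\<in>inversion_pairs n. replicate_mset (tree_card s T y x) (y, x))"

definition add_inversion ::
  "(nat \<Rightarrow> nat) \<Rightarrow> (nat \<times> nat) multiset \<Rightarrow> nat \<Rightarrow> nat \<Rightarrow> (nat \<times> nat) multiset" where
  "add_inversion s I b a = (if count I (b, a) < s b then add_mset (b, a) I else I)"

definition mset_transitive :: "(nat \<times> nat) multiset \<Rightarrow> bool" where
  "mset_transitive I \<longleftrightarrow>
     (\<forall>a b c. a < b \<and> b < c \<longrightarrow> count I (b, a) = 0 \<or> count I (c, a) \<ge> count I (c, b))"

(* J is the smallest transitive multiset of inversion pairs containing I *)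
definition is_transitive_closure ::
  "nat \<Rightarrow> (nat \<times> nat) multiset \<Rightarrow> (nat \<times> nat) multiset \<Rightarrow> bool" where
  "is_transitive_closure n I J \<longleftrightarrow>
     set_mset J \<subseteq> inversion_pairs n \<and> mset_transitive J \<and> I \<subseteq># J \<and>
     (\<forall>K. set_mset K \<subseteq> inversion_pairs n \<and> mset_transitive K \<and> I \<subseteq># K \<longrightarrow> J \<subseteq># K)"

section \<open>The s-Tamari lattice\<close>

definition s_tamari_tree :: "nat \<Rightarrow> (nat \<Rightarrow> nat) \<Rightarrow> ltree \<Rightarrow> bool" where
  "s_tamari_tree n s T \<longleftrightarrow>
     s_decreasing_tree n s T \<and>
     (\<forall>a b c. 1 \<le> a \<and> a < b \<and> b < c \<and> c \<le> n \<longrightarrow> tree_card s T c a \<le> tree_card s T c b)"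

(* the order is the restriction of the s-weak order to s-Tamari trees *)
definition s_tamari :: "nat \<Rightarrow> (nat \<Rightarrow> nat) \<Rightarrow> ltree gorder" where
  "s_tamari n s =
     \<lparr> carrier = {T. s_tamari_tree n s T},
       eq = (=),
       le = (\<lambda>T Z. tree_inv n s T \<subseteq># tree_inv n s Z) \<rparr>"

definition tamari_ascent :: "(nat \<Rightarrow> nat) \<Rightarrow> ltree \<Rightarrow> nat \<Rightarrow> nat \<Rightarrow> bool" where
  "tamari_ascent s T a b \<longleftrightarrow> a < b \<and> child_of T a b \<and> tree_card s T b a < s b"

definition is_tamari_rotation ::
  "nat \<Rightarrow> (nat \<Rightarrow> nat) \<Rightarrow> ltree \<Rightarrow> nat \<Rightarrow> nat \<Rightarrow> ltree \<Rightarrow> bool" where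
  "is_tamari_rotation n s T a b Z \<longleftrightarrow>
     s_tamari_tree n s Z \<and>
     is_transitive_closure n (add_inversion s (tree_inv n s T) b a) (tree_inv n s Z)"

(* meaningful only when Z covers T in the s-Tamari lattice *)
definition tamari_label :: "nat \<Rightarrow> (nat \<Rightarrow> nat) \<Rightarrow> ltree \<Rightarrow> ltree \<Rightarrow> nat" where
  "tamari_label n s T Z =
     fst (THE (a, b). tamari_ascent s T a b \<and> is_tamari_rotation n s T a b Z)"

section \<open>SB-labelings\<close>

definition covers :: "('a, 'm) gorder_scheme \<Rightarrow> 'a \<Rightarrow> 'a \<Rightarrow> bool" where
  "covers L x y \<longleftrightarrow>
     x \<in> carrier L \<and> y \<in> carrier L \<and> x \<sqsubset>\<^bsub>L\<^esub> y \<and>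
     \<not> (\<exists>z\<in>carrier L. x \<sqsubset>\<^bsub>L\<^esub> z \<and> z \<sqsubset>\<^bsub>L\<^esub> y)"

definition saturated_chain ::
  "('a, 'm) gorder_scheme \<Rightarrow> 'a \<Rightarrow> 'a \<Rightarrow> 'a list \<Rightarrow> bool" where
  "saturated_chain L x y cs \<longleftrightarrow>
     cs \<noteq> [] \<and> hd cs = x \<and> last cs = y \<and> set cs \<subseteq> carrier L \<and>
     (\<forall>i. Suc i < length cs \<longrightarrow> covers L (cs ! i) (cs ! Suc i))"

definition chain_labels :: "('a \<Rightarrow> 'a \<Rightarrow> 'b) \<Rightarrow> 'a list \<Rightarrow> 'b set" where
  "chain_labels lam cs = {lam (cs ! i) (cs ! Suc i) | i. Suc i < length cs}"

(* An edge labeling is a function of two lattice elements; only its values on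
   cover relations are used. *)
definition SB_labeling ::
  "('a, 'm) gorder_scheme \<Rightarrow> ('a \<Rightarrow> 'a \<Rightarrow> 'b) \<Rightarrow> bool" where
  "SB_labeling L lam \<longleftrightarrow>
     finite (carrier L) \<and> lattice L \<and>
     (\<forall>u v w. covers L u v \<and> covers L u w \<and> v \<noteq> w \<longrightarrow>
        lam u v \<noteq> lam u w \<and>
        (\<forall>cs. saturated_chain L u (v \<squnion>\<^bsub>L\<^esub> w) cs \<longrightarrow>
           lam u v \<in> chain_labels lam cs \<and> lam u w \<in> chain_labels lam cs) \<and>
        (\<forall>cs. saturated_chain L u (v \<squnion>\<^bsub>L\<^esub> w) cs \<longrightarrow>
           chain_labels lam cs \<subseteq> {lam u v, lam u w}))"

end

theory Submission
  imports Defs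
begin

text \<open>An s-Tamari tree \<open>T\<close> is encoded by the function \<open>f y x = #\<^sub>T(y, x)\<close>, whose rows \<open>f y\<close> are
  increasing, bounded by \<open>s y\<close>, and satisfy: \<open>f b a > 0\<close> implies \<open>f c a = f c b\<close> for \<open>a < b < c\<close>.
  Every such function comes from exactly one tree, and the class is closed under pointwise infima,
  which gives the lattice.  The rotation along \<open>(a, b)\<close> raises row \<open>b\<close> by one on an interval of
  columns ending in \<open>a\<close>.  If \<open>(a, b)\<close> and \<open>(a', b')\<close> are two ascents of \<open>f\<close>, the first preceding the
  second lexicographically by row and column, then \<open>(a', b')\<close> is still an ascent after the rotation
  along \<open>(a, b)\<close>, and performing both rotations yields an upper bound \<open>J\<close> of both.  An ascent
  \<open>(c, d)\<close> of a function \<open>p\<close> between \<open>f\<close> and \<open>J\<close> satisfies \<open>f d c < J d c\<close>, and \<open>f y c = 0\<close> for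
  \<open>c < y < d\<close>, because otherwise \<open>p d c = p d y\<close>; this leaves only \<open>c = a\<close> and \<open>c = a'\<close>.\<close>

section \<open>Recursive description of the cardinalities\<close>

text \<open>The label set is left open, so that the property passes to the children of a node and
  structural induction applies.\<close>

definition decreasing_ltree :: "(nat \<Rightarrow> nat) \<Rightarrow> ltree \<Rightarrow> bool" where
  "decreasing_ltree s T \<longleftrightarrow> distinct (labels T) \<and>
     (\<forall>i ts. Node i ts \<in> subtrees T \<longrightarrow>
        length ts = s i + 1 \<and> (\<forall>t\<in>set ts. \<forall>x\<in>set (labels t). x < i))"

lemma s_decreasing_tree_iff:
  "s_decreasing_tree n s T \<longleftrightarrow> decreasing_ltree s T \<and> set (labels T) = {1..n}"
  by (auto simp: s_decreasing_tree_def decreasing_ltree_def)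

text \<open>Siblings are compared by index, because several children of one node may be the same
  \<open>Leaf\<close>.\<close>

lemma distinct_concat_map_iff:
  "distinct (concat (map f xs)) \<longleftrightarrow>
     (\<forall>x\<in>set xs. distinct (f x)) \<and>
     (\<forall>i j. i < j \<and> j < length xs \<longrightarrow> set (f (xs ! i)) \<inter> set (f (xs ! j)) = {})"
  (is "?L xs \<longleftrightarrow> ?R xs")
proof (induction xs)
  case (Cons x xs)
  have "(\<forall>i j. i < j \<and> j < length (x # xs) \<longrightarrow>
            set (f ((x # xs) ! i)) \<inter> set (f ((x # xs) ! j)) = {}) \<longleftrightarrow>
        (\<forall>y\<in>set xs. set (f x) \<inter> set (f y) = {}) \<and>
        (\<forall>i j. i < j \<and> j < length xs \<longrightarrow> set (f (xs ! i)) \<inter> set (f (xs ! j)) = {})"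
    (is "?A \<longleftrightarrow> ?B \<and> ?C")
  proof
    assume a: ?A
    have ?B
    proof
      fix y assume "y \<in> set xs"
      then obtain j where "j < length xs" "y = xs ! j" by (auto simp: in_set_conv_nth)
      with a[rule_format, of 0 "Suc j"] show "set (f x) \<inter> set (f y) = {}" by simp
    qed
    moreover have ?C
    proof (intro allI impI)
      fix i j assume "i < j \<and> j < length xs"
      with a[rule_format, of "Suc i" "Suc j"]
      show "set (f (xs ! i)) \<inter> set (f (xs ! j)) = {}" by simp
    qed
    ultimately show "?B \<and> ?C" ..
  next
    assume bc: "?B \<and> ?C"
    show ?A
    proof (intro allI impI)
      fix i j assume ij: "i < j \<and> j < length (x # xs)"
      then obtain j' where "j = Suc j'" by (cases j) auto
      with bc ij show "set (f ((x # xs) ! i)) \<inter> set (f ((x # xs) ! j)) = {}"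
        by (cases i) auto
    qed
  qed
  with Cons show ?case by auto
qed simp

section \<open>Trees as a root with a list of children\<close>

lemma decreasing_ltree_Leaf [simp]: "decreasing_ltree s Leaf"
  by (simp add: decreasing_ltree_def)

lemma decreasing_ltree_Node:
  "decreasing_ltree s (Node r ts) \<longleftrightarrow>
     length ts = s r + 1 \<and> (\<forall>t\<in>set ts. decreasing_ltree s t) \<and>
     (\<forall>t\<in>set ts. \<forall>x\<in>set (labels t). x < r) \<and>
     (\<forall>i j. i < j \<and> j < length ts \<longrightarrow>
        set (labels (ts ! i)) \<inter> set (labels (ts ! j)) = {})"
  by (auto simp: decreasing_ltree_def distinct_concat_map_iff; blast)

locale decreasing_node =
  fixes s :: "nat \<Rightarrow> nat" and r :: nat and ts :: "ltree list"
  assumes dec: "decreasing_ltree s (Node r ts)"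
begin

lemma length_children: "length ts = s r + 1"
  using dec by (simp add: decreasing_ltree_Node)

lemma decreasing_child: "k < length ts \<Longrightarrow> decreasing_ltree s (ts ! k)"
  using dec by (simp add: decreasing_ltree_Node)

lemma label_less_root: "k < length ts \<Longrightarrow> x \<in> set (labels (ts ! k)) \<Longrightarrow> x < r"
  using dec nth_mem[of k ts] by (auto simp only: decreasing_ltree_Node)

lemma child_unique:
  assumes "k < length ts" "l < length ts" "x \<in> set (labels (ts ! k))" "x \<in> set (labels (ts ! l))"
  shows "k = l"
proof (rule ccontr)
  assume "k \<noteq> l"
  then have "k < l \<or> l < k" by auto
  with assms dec show False unfolding decreasing_ltree_Node by blast
qed

lemma label_cases:
  assumes "x \<in> set (labels (Node r ts))"
  obtains "x = r" | k where "k < length ts" "x \<in> set (labels (ts ! k))"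
  using assms by (auto simp: in_set_conv_nth) (metis in_set_conv_nth)

end

lemma root_in_labels: "Node y ts \<in> subtrees T \<Longrightarrow> y \<in> set (labels T)"
  by (induction T) auto

lemma labels_subtree: "Node y ts \<in> subtrees T \<Longrightarrow> t \<in> set ts \<Longrightarrow> set (labels t) \<subseteq> set (labels T)"
  by (induction T) auto

lemma in_child_subtree_labels:
  "in_child_subtree T y j x \<Longrightarrow> y \<in> set (labels T) \<and> x \<in> set (labels T)"
  unfolding in_child_subtree_def by (meson root_in_labels labels_subtree nth_mem subsetD)

lemma left_of_labels: "left_of T x y \<Longrightarrow> x \<in> set (labels T) \<and> y \<in> set (labels T)"
  unfolding left_of_def by (meson in_child_subtree_labels)

lemma child_of_labels: "child_of T a b \<Longrightarrow> a \<in> set (labels T) \<and> b \<in> set (labels T)"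
proof -
  assume "child_of T a b"
  then obtain ts us where t: "Node b ts \<in> subtrees T" "Node a us \<in> set ts"
    by (auto simp: child_of_def)
  show ?thesis
    using root_in_labels[OF t(1)] labels_subtree[OF t] by auto
qed

lemma Node_in_subtrees_Node:
  "Node y us \<in> subtrees (Node r ts) \<longleftrightarrow>
     y = r \<and> us = ts \<or> (\<exists>k<length ts. Node y us \<in> subtrees (ts ! k))"
  using nth_mem by (fastforce simp: in_set_conv_nth)

lemma in_child_subtree_Node:
  "in_child_subtree (Node r ts) y j x \<longleftrightarrow>
     y = r \<and> j < length ts \<and> x \<in> set (labels (ts ! j)) \<or>
     (\<exists>k<length ts. in_child_subtree (ts ! k) y j x)"
  unfolding in_child_subtree_def Node_in_subtrees_Node by blast

lemma child_of_Node:
  "child_of (Node r ts) a b \<longleftrightarrow>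
     b = r \<and> (\<exists>us. Node a us \<in> set ts) \<or> (\<exists>k<length ts. child_of (ts ! k) a b)"
  unfolding child_of_def Node_in_subtrees_Node by blast

context decreasing_node
begin

lemma in_child_subtree_root:
  "in_child_subtree (Node r ts) r j x \<longleftrightarrow> j < length ts \<and> x \<in> set (labels (ts ! j))"
  using in_child_subtree_labels label_less_root by (fastforce simp: in_child_subtree_Node)

lemma in_child_subtree_child:
  assumes "k < length ts" "y \<in> set (labels (ts ! k))"
  shows "in_child_subtree (Node r ts) y j x \<longleftrightarrow> in_child_subtree (ts ! k) y j x"
  using assms in_child_subtree_labels label_less_root child_unique
  by (metis in_child_subtree_Node nat_neq_iff)

lemma left_of_Node:
  "left_of (Node r ts) x y \<longleftrightarrow>
     (\<exists>i j. i < j \<and> j < length ts \<and> x \<in> set (labels (ts ! i)) \<and> y \<in> set (labels (ts ! j))) \<or>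
     (\<exists>k<length ts. left_of (ts ! k) x y)" (is "?L \<longleftrightarrow> ?R")
proof
  assume ?L
  then obtain z i j where z: "i < j" "in_child_subtree (Node r ts) z i x"
      "in_child_subtree (Node r ts) z j y"
    by (auto simp: left_of_def)
  have "z \<in> set (labels (Node r ts))" using z(2) in_child_subtree_labels by blast
  then show ?R
  proof (cases rule: label_cases)
    case 1
    with z show ?thesis by (auto simp: in_child_subtree_root)
  next
    case (2 k)
    with z have "in_child_subtree (ts ! k) z i x" "in_child_subtree (ts ! k) z j y"
      by (simp_all add: in_child_subtree_child)
    with 2 z(1) show ?thesis by (auto simp: left_of_def)
  qed
next
  assume ?R
  then show ?L
    unfolding left_of_def using in_child_subtree_root in_child_subtree_Node
    by (meson order.strict_trans)
qed

lemma left_of_same_child: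
  assumes "k < length ts" "x \<in> set (labels (ts ! k))" "y \<in> set (labels (ts ! k))"
  shows "left_of (Node r ts) x y \<longleftrightarrow> left_of (ts ! k) x y"
  using assms child_unique left_of_labels unfolding left_of_Node
  by (metis nat_neq_iff order.strict_trans)

text \<open>The index \<open>k\<close> agrees with all three branches of \<open>tree_card\<close>,
  as the last child of \<open>r\<close> has index \<open>s r\<close>. Together with the next three
  lemmas this computes every cardinality from child indices at the root, with recursion only when
  \<open>x\<close> and \<open>y\<close> share a child.\<close>

lemma tree_card_root:
  assumes "k < length ts" "x \<in> set (labels (ts ! k))"
  shows "tree_card s (Node r ts) r x = k"
proof -
  have "\<not> left_of (Node r ts) x r"
    using label_less_root left_of_labels unfolding left_of_Node by blast
  moreover have "in_child_subtree (Node r ts) r i x \<longleftrightarrow> i = k" for i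
    using assms child_unique by (auto simp: in_child_subtree_root)
  ultimately show ?thesis
    using assms length_children by (auto simp: tree_card_def)
qed

lemma tree_card_same_child:
  assumes "k < length ts" "x \<in> set (labels (ts ! k))" "y \<in> set (labels (ts ! k))"
  shows "tree_card s (Node r ts) y x = tree_card s (ts ! k) y x"
  unfolding tree_card_def left_of_same_child[OF assms]
    in_child_subtree_child[OF assms(1,3)] ..

lemma tree_card_left_child:
  assumes "k < l" "l < length ts" "x \<in> set (labels (ts ! k))" "y \<in> set (labels (ts ! l))"
  shows "tree_card s (Node r ts) y x = 0"
  using assms by (auto simp: tree_card_def left_of_Node)

text \<open>Here \<open>x\<close> is neither left of \<open>y\<close> nor below it, so
  \<open>tree_card\<close> falls through to its default value \<open>s y\<close>.\<close>

lemma tree_card_right_child: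
  assumes "l < k" "k < length ts" "x \<in> set (labels (ts ! k))" "y \<in> set (labels (ts ! l))"
  shows "tree_card s (Node r ts) y x = s y"
proof -
  have l: "l < length ts" using assms by simp
  have "x \<notin> set (labels (ts ! l))"
    using assms child_unique[of k l x] by auto
  then have "\<not> in_child_subtree (Node r ts) y j x" for j
    using in_child_subtree_child[OF l assms(4)] in_child_subtree_labels by blast
  moreover have "\<not> left_of (Node r ts) x y"
    using assms l child_unique left_of_labels unfolding left_of_Node
    by (metis nat_neq_iff order.strict_trans)
  ultimately show ?thesis by (simp add: tree_card_def)
qed

end

section \<open>Constraints on the cardinalities, and recovery of a tree from them\<close>

lemma tree_card_le:
  assumes "decreasing_ltree s T" "x \<in> set (labels T)" "y \<in> set (labels T)" "x < y"
  shows "tree_card s T y x \<le> s y"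
  using assms
proof (induction T)
  case (Node r ts)
  interpret decreasing_node s r ts using Node.prems by unfold_locales
  have "x \<noteq> r"
    using Node.prems(3,4) label_less_root by (metis label_cases order.asym order.irrefl)
  then obtain k where k: "k < length ts" "x \<in> set (labels (ts ! k))"
    using Node.prems(2) by (metis label_cases)
  show ?case
    using Node.prems(3)
  proof (cases rule: label_cases)
    case 1
    with k length_children show ?thesis by (simp add: tree_card_root)
  next
    case (2 l)
    consider "k < l" | "k = l" | "l < k" by linarith
    then show ?thesis
    proof cases
      case 2
      with k \<open>y \<in> set (labels (ts ! l))\<close> Node show ?thesis
        by (simp add: tree_card_same_child decreasing_child)
    qed (use k 2 in \<open>simp_all add: tree_card_left_child tree_card_right_child\<close>)
  qed
qed simp

text \<open>Compare the root children \<open>i\<close>, \<open>j\<close>, \<open>k\<close>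
  containing \<open>a\<close>, \<open>b\<close>, \<open>c\<close>. If \<open>i < j\<close>, then the
  entry \<open>(b, a)\<close> is 0; if \<open>j < k\<close>, then \<open>(c, b)\<close> is 0; if
  \<open>k < i\<close>, then \<open>(c, a)\<close> has its maximal value \<open>s c\<close>.
  Otherwise all three indices are equal and induction applies. If \<open>c\<close> is the root, the
  entries \<open>(c, a)\<close> and \<open>(c, b)\<close> are \<open>i\<close> and \<open>j\<close>
  themselves.\<close>

lemma tree_card_transitive:
  assumes "decreasing_ltree s T" "{a, b, c} \<subseteq> set (labels T)" "a < b" "b < c"
  shows "tree_card s T b a = 0 \<or> tree_card s T c b \<le> tree_card s T c a"
  using assms
proof (induction T)
  case (Node r ts)
  interpret decreasing_node s r ts using Node.prems by unfold_locales
  have "a \<noteq> r" "b \<noteq> r"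
    using Node.prems label_less_root by (metis insert_subset label_cases order.asym order.irrefl)+
  then obtain i j where i: "i < length ts" "a \<in> set (labels (ts ! i))"
      and j: "j < length ts" "b \<in> set (labels (ts ! j))"
    using Node.prems(2) by (metis insert_subset label_cases)
  have "c \<in> set (labels (Node r ts))" using Node.prems(2) by simp
  then show ?case
  proof (cases rule: label_cases)
    case 1
    then have "tree_card s (Node r ts) c a = i" "tree_card s (Node r ts) c b = j"
      using i j by (simp_all only: tree_card_root)
    then show ?thesis
      using i j tree_card_left_child[of i j a b] by (cases "i < j") auto
  next
    case (2 k)
    have ij: "i < j \<Longrightarrow> tree_card s (Node r ts) b a = 0"
      using tree_card_left_child i j by blast
    have jk: "j < k \<Longrightarrow> tree_card s (Node r ts) c b = 0"
      using tree_card_left_child j 2 by blast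
    have ki: "k < i \<Longrightarrow> tree_card s (Node r ts) c a = s c"
      using tree_card_right_child i 2 by blast
    have le: "tree_card s (Node r ts) c b \<le> s c"
      using tree_card_le Node.prems by simp
    have "i = k \<and> j = k \<Longrightarrow> ?thesis"
      using Node.IH[OF nth_mem[OF i(1)]] Node.prems i j 2
      by (simp add: tree_card_same_child decreasing_child)
    with ij jk ki le show ?thesis by (metis le0 linorder_neqE_nat order.strict_trans)
  qed
qed simp

text \<open>The root is the largest label, and its \<open>k\<close>-th child carries exactly the
  labels \<open>x\<close> whose cardinality with respect to the root is \<open>k\<close>. So both
  trees have the same root and the same label sets in corresponding children, and induction
  finishes.\<close>

lemma tree_card_inj:
  assumes "decreasing_ltree s T" "decreasing_ltree s Z" "set (labels T) = set (labels Z)"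
    and "\<And>x y. x \<in> set (labels T) \<Longrightarrow> y \<in> set (labels T) \<Longrightarrow> x < y \<Longrightarrow>
           tree_card s T y x = tree_card s Z y x"
  shows "T = Z"
  using assms
proof (induction T arbitrary: Z)
  case Leaf
  then show ?case by (cases Z) auto
next
  case (Node r ts)
  then obtain q us where Z: "Z = Node q us" by (cases Z) auto
  interpret T: decreasing_node s r ts using Node.prems by unfold_locales
  interpret Z: decreasing_node s q us using Node.prems Z by unfold_locales simp
  have "r \<in> set (labels (Node q us))" "q \<in> set (labels (Node r ts))"
    using Node.prems(3) Z by auto
  then have "r \<le> q" "q \<le> r"
    by (metis Z.label_cases Z.label_less_root order.refl order.strict_implies_order,
        metis T.label_cases T.label_less_root order.refl order.strict_implies_order)
  then have q: "q = r" by simp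
  have len: "length ts = length us" using T.length_children Z.length_children q by simp
  have iff: "x \<in> set (labels (ts ! k)) \<longleftrightarrow> x \<in> set (labels (us ! k))" if k: "k < length ts" for x k
  proof -
    have "x \<in> set (labels (ts ! k)) \<longleftrightarrow>
        x \<in> set (labels (Node r ts)) \<and> x \<noteq> r \<and> tree_card s (Node r ts) r x = k"
      using k T.label_less_root T.tree_card_root
      by (metis T.label_cases T.in_child_subtree_root in_child_subtree_labels order.irrefl)
    moreover have "x \<in> set (labels (us ! k)) \<longleftrightarrow>
        x \<in> set (labels Z) \<and> x \<noteq> r \<and> tree_card s Z r x = k"
      using k len q Z Z.label_less_root Z.tree_card_root
      by (metis Z.label_cases Z.in_child_subtree_root in_child_subtree_labels order.irrefl)
    moreover have "tree_card s (Node r ts) r x = tree_card s Z r x"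
      if "x \<in> set (labels (Node r ts))" "x \<noteq> r"
      using that Node.prems(4) T.label_less_root
      by (metis T.label_cases labels.simps(2) list.set_intros(1))
    ultimately show ?thesis using Node.prems(3) by metis
  qed
  have "ts ! k = us ! k" if k: "k < length ts" for k
  proof (rule Node.IH)
    show "ts ! k \<in> set ts" "decreasing_ltree s (ts ! k)" "decreasing_ltree s (us ! k)"
      using k len T.decreasing_child Z.decreasing_child by auto
    show "set (labels (ts ! k)) = set (labels (us ! k))" using iff[OF k] by blast
    fix x y assume xy: "x \<in> set (labels (ts ! k))" "y \<in> set (labels (ts ! k))" "x < y"
    then have "x \<in> set (labels (Node r ts))" "y \<in> set (labels (Node r ts))"
      using k by auto
    then have "tree_card s (Node r ts) y x = tree_card s Z y x" using Node.prems(4) xy(3) by blast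
    then show "tree_card s (ts ! k) y x = tree_card s (us ! k) y x"
      using k len xy iff[OF k] T.tree_card_same_child Z.tree_card_same_child by (simp add: Z)
  qed
  then show ?case using len q Z by (simp add: nth_equalityI)
qed

text \<open>The tree is built from the top: the root is \<open>Max A\<close>, and the labels
  \<open>x\<close> with \<open>f r x = j\<close> form the \<open>j\<close>-th child. The hypotheses
  pass to subsets, hence the general finite set \<open>A\<close>. For \<open>x < y\<close> in
  different children, monotonicity of row \<open>r\<close> puts \<open>x\<close> left of
  \<open>y\<close>, and the transitivity hypothesis then gives \<open>f y x = 0\<close>, as the tree
  requires.\<close>

lemma tree_card_surj:
  assumes "finite A"
    and "\<And>x y. x \<in> A \<Longrightarrow> y \<in> A \<Longrightarrow> x < y \<Longrightarrow> f y x \<le> s y"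
    and "\<And>a b c. {a, b, c} \<subseteq> A \<Longrightarrow> a < b \<Longrightarrow> b < c \<Longrightarrow> f c a \<le> f c b"
    and "\<And>a b c. {a, b, c} \<subseteq> A \<Longrightarrow> a < b \<Longrightarrow> b < c \<Longrightarrow> f b a = 0 \<or> f c b \<le> f c a"
  shows "\<exists>T. decreasing_ltree s T \<and> set (labels T) = A \<and>
           (\<forall>x\<in>A. \<forall>y\<in>A. x < y \<longrightarrow> tree_card s T y x = f y x)"
  using assms
proof (induction A rule: finite_psubset_induct)
  case (psubset A)
  show ?case
  proof (cases "A = {}")
    case True
    then show ?thesis by (intro exI[of _ Leaf]) auto
  next
    case False
    define r where "r = Max A"
    define B where "B j = {x \<in> A. x < r \<and> f r x = j}" for j
    have rA: "r \<in> A" and r: "\<And>x. x \<in> A \<Longrightarrow> x \<le> r"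
      using False psubset.hyps by (auto simp: r_def)
    have "\<exists>T. decreasing_ltree s T \<and> set (labels T) = B j \<and>
            (\<forall>x\<in>B j. \<forall>y\<in>B j. x < y \<longrightarrow> tree_card s T y x = f y x)" for j
    proof (rule psubset.IH)
      show "B j \<subset> A" using rA by (auto simp: B_def)
    qed (use psubset.prems in \<open>auto simp: B_def\<close>)
    then obtain t where t: "\<And>j. decreasing_ltree s (t j)" "\<And>j. set (labels (t j)) = B j"
      "\<And>j x y. x \<in> B j \<Longrightarrow> y \<in> B j \<Longrightarrow> x < y \<Longrightarrow> tree_card s (t j) y x = f y x"
      by metis
    define ts where "ts = map t [0..<s r + 1]"
    have len: "length ts = s r + 1" and nth: "\<And>j. j < s r + 1 \<Longrightarrow> ts ! j = t j"
      by (simp_all add: ts_def del: upt_Suc)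
    have dec: "decreasing_ltree s (Node r ts)"
      unfolding decreasing_ltree_Node
      using t(1,2) by (auto simp: len nth) (auto simp: ts_def B_def simp del: upt_Suc)
    interpret decreasing_node s r ts by unfold_locales (fact dec)
    have B: "x \<in> B (f r x) \<and> f r x < length ts" if "x \<in> A" "x < r" for x
      using psubset.prems(1)[OF that(1) rA that(2)] that by (auto simp: B_def len)
    have "set (labels (Node r ts)) = insert r (\<Union>j<s r + 1. B j)"
      by (auto simp: ts_def t(2) simp del: upt_Suc)
    also have "\<dots> = A"
      using B rA r len by (auto simp: B_def) (metis le_neq_implies_less less_Suc_eq)
    finally have lab: "set (labels (Node r ts)) = A" .
    have "tree_card s (Node r ts) y x = f y x" if xy: "x \<in> A" "y \<in> A" "x < y" for x y
    proof -
      have xr: "x < r" using xy r by (meson order.strict_trans2)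
      then have x: "f r x < length ts" "x \<in> set (labels (ts ! f r x))"
        using B[OF xy(1)] by (auto simp: nth t(2) len)
      show ?thesis
      proof (cases "y = r")
        case True
        with x show ?thesis by (simp add: tree_card_root)
      next
        case False
        then have yr: "y < r" using r xy(2) by (simp add: order.strict_iff_order)
        then have y: "f r y < length ts" "y \<in> set (labels (ts ! f r y))"
          using B[OF xy(2)] by (auto simp: nth t(2) len)
        have le: "f r x \<le> f r y" using psubset.prems(2)[of x y r] xy yr rA by simp
        show ?thesis
        proof (cases "f r x = f r y")
          case True
          have "tree_card s (ts ! f r y) y x = f y x"
            using t(3)[of x "f r y" y] B xy xr yr True y(1) nth len by metis
          with x y True show ?thesis by (metis tree_card_same_child)
        next
          case False
          with psubset.prems(3)[of x y r] xy yr rA le have "f y x = 0" by auto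
          with False le x y tree_card_left_child[of "f r x" "f r y" x y] show ?thesis by auto
        qed
      qed
    qed
    with dec lab show ?thesis by blast
  qed
qed

section \<open>The child relation read off from the cardinalities\<close>

lemma root_ge_labels: "decreasing_ltree s (Node r ts) \<Longrightarrow> x \<in> set (labels (Node r ts)) \<Longrightarrow> x \<le> r"
  by (auto simp: decreasing_ltree_Node intro: order.strict_implies_order)

text \<open>If \<open>b\<close> is the root, the second condition is vacuous and the first says that
  \<open>a\<close> is the largest label in its child of \<open>b\<close>. Otherwise, if
  \<open>a\<close> and \<open>b\<close> lie in different children of the root \<open>r\<close>, then
  \<open>z = r\<close> violates the second condition. If they share a child, both conditions may be
  restricted to it: by monotonicity every label between \<open>a\<close> and \<open>b\<close> lies
  there too, and every vertex outside has equal cardinalities with \<open>a\<close> and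
  \<open>b\<close>.\<close>

lemma child_of_iff:
  assumes "decreasing_ltree s T"
    and "\<And>a b c. {a, b, c} \<subseteq> set (labels T) \<Longrightarrow> a < b \<Longrightarrow> b < c \<Longrightarrow>
           tree_card s T c a \<le> tree_card s T c b"
    and "a \<in> set (labels T)" "b \<in> set (labels T)" "a < b"
  shows "child_of T a b \<longleftrightarrow>
     (\<forall>x\<in>set (labels T). a < x \<and> x < b \<longrightarrow> tree_card s T b a < tree_card s T b x) \<and>
     (\<forall>z\<in>set (labels T). b < z \<longrightarrow> tree_card s T z a = tree_card s T z b)"
  using assms
proof (induction T)
  case (Node r ts)
  interpret decreasing_node s r ts using Node.prems by unfold_locales
  let ?L = "set (labels (Node r ts))"
  let ?f = "tree_card s (Node r ts)"
  have rL: "r \<in> ?L" by simp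
  have less: "x < r" if "x \<in> ?L" "x \<noteq> r" for x
    using that label_less_root by (metis label_cases)
  have sub: "x \<in> ?L" if "k < length ts" "x \<in> set (labels (ts ! k))" for k x
    using that by auto
  have "a \<noteq> r" using Node.prems(4,5) less[of b] by (metis order.asym order.irrefl)
  then obtain k where k: "k < length ts" "a \<in> set (labels (ts ! k))"
    using Node.prems by (metis label_cases)
  have fa: "?f r a = k" using k by (rule tree_card_root)
  show ?case
  proof (cases "b = r")
    case True
    have "child_of (Node r ts) a b \<longleftrightarrow> (\<exists>us. Node a us \<in> set ts)"
      using True child_of_labels label_less_root unfolding child_of_Node by (metis order.irrefl)
    also have "\<dots> \<longleftrightarrow> (\<exists>us. ts ! k = Node a us)"
    proof
      assume "\<exists>us. Node a us \<in> set ts"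
      then obtain us l where l: "l < length ts" "ts ! l = Node a us"
        by (metis in_set_conv_nth)
      then have "l = k" using child_unique[of l k a] k by simp
      with l show "\<exists>us. ts ! k = Node a us" by blast
    qed (metis k(1) nth_mem)
    also have "\<dots> \<longleftrightarrow> (\<forall>x\<in>set (labels (ts ! k)). x \<le> a)"
    proof
      assume "\<exists>us. ts ! k = Node a us"
      then show "\<forall>x\<in>set (labels (ts ! k)). x \<le> a"
        using decreasing_child[OF k(1)] root_ge_labels by metis
    next
      assume le: "\<forall>x\<in>set (labels (ts ! k)). x \<le> a"
      obtain q us where q: "ts ! k = Node q us" using k by (cases "ts ! k") auto
      then have "q \<le> a" "a \<le> q"
        using le k decreasing_child[OF k(1)] root_ge_labels by auto
      with q show "\<exists>us. ts ! k = Node a us" by auto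
    qed
    also have "\<dots> \<longleftrightarrow> (\<forall>x\<in>?L. a < x \<and> x < b \<longrightarrow> ?f b a < ?f b x)"
    proof
      assume le: "\<forall>x\<in>set (labels (ts ! k)). x \<le> a"
      show "\<forall>x\<in>?L. a < x \<and> x < b \<longrightarrow> ?f b a < ?f b x"
      proof (intro ballI impI)
        fix x assume x: "x \<in> ?L" "a < x \<and> x < b"
        then obtain l where l: "l < length ts" "x \<in> set (labels (ts ! l))"
          using True by (metis label_cases order.irrefl)
        then have "l \<noteq> k" using le x by (metis not_le)
        moreover have "?f r a \<le> ?f r x"
          using Node.prems x True by (intro Node.prems(2)) auto
        ultimately show "?f b a < ?f b x" using True fa tree_card_root[OF l] by simp
      qed
    next
      assume *: "\<forall>x\<in>?L. a < x \<and> x < b \<longrightarrow> ?f b a < ?f b x"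
      show "\<forall>x\<in>set (labels (ts ! k)). x \<le> a"
      proof (intro ballI leI notI)
        fix x assume x: "x \<in> set (labels (ts ! k))" "a < x"
        then have "?f r a < ?f r x" using * True k label_less_root sub by metis
        then show False using fa tree_card_root[OF k(1) x(1)] by simp
      qed
    qed
    finally show ?thesis using True less by (metis order.asym)
  next
    case False
    then obtain l where l: "l < length ts" "b \<in> set (labels (ts ! l))"
      using Node.prems by (metis label_cases)
    have fb: "?f r b = l" using l by (rule tree_card_root)
    have br: "b < r" using less False Node.prems by blast
    have child: "child_of (Node r ts) a b \<longleftrightarrow> child_of (ts ! l) a b"
      using False l child_of_labels child_unique unfolding child_of_Node by metis
    have ?thesis if "k \<noteq> l"
    proof -
      have "\<not> child_of (ts ! l) a b" using that k l child_unique child_of_labels by metis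
      then show ?thesis using child rL br fa fb that by metis
    qed
    moreover have ?thesis if kl: "k = l"
    proof -
      have a: "a \<in> set (labels (ts ! l))" using k kl by simp
      have same: "tree_card s (ts ! l) y x = ?f y x"
        if "x \<in> set (labels (ts ! l))" "y \<in> set (labels (ts ! l))" for x y
        using tree_card_same_child[OF l(1) that] by simp
      have "child_of (ts ! l) a b \<longleftrightarrow>
         (\<forall>x\<in>set (labels (ts ! l)). a < x \<and> x < b \<longrightarrow>
            tree_card s (ts ! l) b a < tree_card s (ts ! l) b x) \<and>
         (\<forall>z\<in>set (labels (ts ! l)). b < z \<longrightarrow>
            tree_card s (ts ! l) z a = tree_card s (ts ! l) z b)"
      proof (rule Node.IH)
        show "ts ! l \<in> set ts" "decreasing_ltree s (ts ! l)"
          using l decreasing_child by auto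
        fix u v w assume "{u, v, w} \<subseteq> set (labels (ts ! l))" "u < v" "v < w"
        then show "tree_card s (ts ! l) w u \<le> tree_card s (ts ! l) w v"
          using Node.prems(2)[of u v w] same sub[OF l(1)] by simp
      qed (use a l Node.prems in auto)
      also have "\<dots> \<longleftrightarrow>
         (\<forall>x\<in>set (labels (ts ! l)). a < x \<and> x < b \<longrightarrow> ?f b a < ?f b x) \<and>
         (\<forall>z\<in>set (labels (ts ! l)). b < z \<longrightarrow> ?f z a = ?f z b)"
        using same a l by simp
      also have "\<dots> \<longleftrightarrow>
         (\<forall>x\<in>?L. a < x \<and> x < b \<longrightarrow> ?f b a < ?f b x) \<and>
         (\<forall>z\<in>?L. b < z \<longrightarrow> ?f z a = ?f z b)"
      proof -
        have "x \<in> set (labels (ts ! l))" if x: "x \<in> ?L" "a < x" "x < b" for x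
        proof -
          have "x \<noteq> r" using x br by simp
          then obtain j where j: "j < length ts" "x \<in> set (labels (ts ! j))"
            using x by (metis label_cases)
          have "?f r a \<le> ?f r x" "?f r x \<le> ?f r b"
            using Node.prems x br by (auto intro!: Node.prems(2))
          then have "j = l" using fa fb tree_card_root[OF j] kl by simp
          with j show ?thesis by simp
        qed
        moreover have "?f z a = ?f z b" if z: "z \<in> ?L" "z \<notin> set (labels (ts ! l))" for z
          using z(1)
        proof (cases rule: label_cases)
          case 1
          with fa fb kl show ?thesis by simp
        next
          case (2 j)
          then have "j < l \<or> l < j" using z(2) by (metis linorder_neqE_nat)
          with 2 l a show ?thesis
            by (metis tree_card_left_child tree_card_right_child)
        qed
        ultimately show ?thesis using sub[OF l(1)] by blast
      qed
      finally show ?thesis using child by simp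
    qed
    ultimately show ?thesis by blast
  qed
qed simp

section \<open>Functions encoding s-Tamari trees\<close>

text \<open>The last two clauses are the s-Tamari condition and transitivity. Vanishing outside the
  inversion pairs makes equality of functions the same as equality of the encoded trees.\<close>

definition tamari_function :: "nat \<Rightarrow> (nat \<Rightarrow> nat) \<Rightarrow> (nat \<Rightarrow> nat \<Rightarrow> nat) \<Rightarrow> bool" where
  "tamari_function n s f \<longleftrightarrow>
     (\<forall>x y. f y x \<le> s y) \<and>
     (\<forall>x y. (y, x) \<notin> inversion_pairs n \<longrightarrow> f y x = 0) \<and>
     (\<forall>a b c. 1 \<le> a \<and> a < b \<and> b < c \<longrightarrow> f c a \<le> f c b) \<and>
     (\<forall>a b c. a < b \<and> b < c \<longrightarrow> f b a = 0 \<or> f c b \<le> f c a)"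

text \<open>The counterpart of \<open>tamari_ascent\<close>: by \<open>child_of_iff\<close> the two
  quantified clauses express that \<open>a\<close> is a child of \<open>b\<close>.\<close>

definition ascent :: "nat \<Rightarrow> (nat \<Rightarrow> nat) \<Rightarrow> (nat \<Rightarrow> nat \<Rightarrow> nat) \<Rightarrow> nat \<Rightarrow> nat \<Rightarrow> bool" where
  "ascent n s f a b \<longleftrightarrow>
     1 \<le> a \<and> a < b \<and> b \<le> n \<and> f b a < s b \<and>
     (\<forall>x. a < x \<and> x < b \<longrightarrow> f b a < f b x) \<and> (\<forall>z>b. f z a = f z b)"

text \<open>Transitivity forces the entries of \<open>block f a\<close> in every later row to be equal to entry \<open>a\<close>, so
  they are raised together with it; monotonicity makes \<open>block f a\<close> an interval ending in \<open>a\<close>.\<close>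

definition block :: "(nat \<Rightarrow> nat \<Rightarrow> nat) \<Rightarrow> nat \<Rightarrow> nat set" where
  "block f a = insert a {x. x < a \<and> 0 < f a x}"

text \<open>On the block all entries of row \<open>b\<close> equal \<open>f b a\<close>
  (\<open>tamari_function_block_eq\<close>), so each of them rises by exactly one. That this is the
  s-Tamari rotation is \<open>is_tamari_rotation_iff\<close>.\<close>

definition rot :: "(nat \<Rightarrow> nat \<Rightarrow> nat) \<Rightarrow> nat \<Rightarrow> nat \<Rightarrow> nat \<Rightarrow> nat \<Rightarrow> nat" where
  "rot f a b = (\<lambda>y x. if y = b \<and> x \<in> block f a then Suc (f b a) else f y x)"

context
  fixes n :: nat and s :: "nat \<Rightarrow> nat" and f :: "nat \<Rightarrow> nat \<Rightarrow> nat"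
  assumes f: "tamari_function n s f"
begin

lemma tamari_function_mono: "1 \<le> a \<Longrightarrow> a \<le> b \<Longrightarrow> b < c \<Longrightarrow> f c a \<le> f c b"
  using f unfolding tamari_function_def by (metis le_neq_implies_less order.refl)

lemma tamari_function_pos: "0 < f y x \<Longrightarrow> 1 \<le> x \<and> x < y \<and> y \<le> n"
  using f unfolding tamari_function_def inversion_pairs_def by fastforce

text \<open>Transitivity gives one inequality and monotonicity the other.\<close>

lemma tamari_function_eq: "0 < f b a \<Longrightarrow> b < c \<Longrightarrow> f c a = f c b"
  using f tamari_function_pos[of b a] unfolding tamari_function_def
  by (metis antisym less_not_refl2)

lemma tamari_function_block_eq: "x \<in> block f a \<Longrightarrow> a < c \<Longrightarrow> f c x = f c a"
  using tamari_function_eq by (auto simp: block_def)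

lemma block_le: "x \<in> block f a \<Longrightarrow> x \<le> a"
  by (auto simp: block_def)

lemma block_ge1: "x \<in> block f a \<Longrightarrow> 1 \<le> a \<Longrightarrow> 1 \<le> x"
  using tamari_function_pos by (auto simp: block_def)

lemma block_closed: "y \<in> block f a \<Longrightarrow> 0 < f y x \<Longrightarrow> x \<in> block f a"
  using tamari_function_eq[of y x a] tamari_function_pos by (fastforce simp: block_def)

lemma block_interval:
  assumes "y \<in> block f a" "y \<le> x" "x \<le> a" "1 \<le> a"
  shows "x \<in> block f a"
proof (cases "x = a")
  case False
  then have "y < a" "0 < f a y" using assms by (auto simp: block_def)
  with assms False tamari_function_mono[of y x a] tamari_function_pos[of a y]
  show ?thesis by (auto simp: block_def)
qed (simp add: block_def)

section \<open>Rotation along a single ascent\<close>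

context
  fixes a b :: nat
  assumes ab: "ascent n s f a b"
begin

lemma ascent_bounds: "1 \<le> a" "a < b" "b \<le> n" "f b a < s b"
  using ab by (simp_all add: ascent_def)

text \<open>A positive \<open>f y a\<close> would force \<open>f b a = f b y\<close>, against the
  strict inequality in \<open>ascent\<close>.\<close>

lemma ascent_zero: "a < y \<Longrightarrow> y < b \<Longrightarrow> f y a = 0"
  using ab tamari_function_eq[of y a b] by (fastforce simp: ascent_def)

lemma rot_ge: "f y x \<le> rot f a b y x"
  using tamari_function_block_eq ascent_bounds by (auto simp: rot_def)

text \<open>Monotonicity can fail only in row \<open>b\<close> between a block column and a column
  beyond \<open>a\<close>, where the strict inequality of the ascent leaves room for one more.
  Transitivity at an old positive entry follows from \<open>block_closed\<close> and the equality of
  old entries in later rows. At a raised entry \<open>(b, x)\<close> it holds because every row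
  after \<open>b\<close> agrees in the columns \<open>x\<close>, \<open>a\<close> and
  \<open>b\<close>.\<close>

lemma tamari_function_rot: "tamari_function n s (rot f a b)"
  unfolding tamari_function_def
proof (intro conjI allI impI)
  fix x y
  show "rot f a b y x \<le> s y"
    using f ascent_bounds by (auto simp: rot_def tamari_function_def)
  show "rot f a b y x = 0" if "(y, x) \<notin> inversion_pairs n"
    using f that ascent_bounds block_ge1[of x a] block_le[of x a]
    by (auto simp: rot_def tamari_function_def inversion_pairs_def)
next
  fix x y z :: nat assume xyz: "1 \<le> x \<and> x < y \<and> y < z"
  show "rot f a b z x \<le> rot f a b z y"
  proof (cases "z = b \<and> x \<in> block f a \<and> y \<notin> block f a")
    case True
    have "a < y"
      using True block_interval[of x a y] xyz ascent_bounds by (meson not_le order.strict_implies_order)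
    with True ab xyz have "f b a < f b y" by (simp add: ascent_def)
    with True show ?thesis by (simp add: rot_def)
  next
    case False
    have "f z x \<le> f z y" using xyz tamari_function_mono by simp
    then show ?thesis using False rot_ge[of z y] by (auto simp: rot_def)
  qed
next
  fix x y z :: nat assume xyz: "x < y \<and> y < z"
  show "rot f a b y x = 0 \<or> rot f a b z y \<le> rot f a b z x"
  proof (cases "0 < f y x")
    case True
    then have eq: "f z x = f z y" using xyz tamari_function_eq by simp
    show ?thesis
    proof (cases "z = b \<and> y \<in> block f a")
      case True
      with block_closed[OF _ \<open>0 < f y x\<close>] show ?thesis by (simp add: rot_def)
    next
      case False
      then have "rot f a b z y = f z y" by (auto simp: rot_def)
      with eq rot_ge[of z x] show ?thesis by simp
    qed
  next
    case False
    show ?thesis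
    proof (cases "y = b \<and> x \<in> block f a")
      case True
      then have "f z x = f z y"
        using ab xyz tamari_function_block_eq[of x a z] by (auto simp: ascent_def)
      with True xyz show ?thesis by (auto simp: rot_def)
    qed (use False in \<open>auto simp: rot_def\<close>)
  qed
qed

text \<open>For a block column \<open>x < a\<close>, \<open>g a x\<close> is positive because
  \<open>f a x\<close> is, so transitivity of \<open>g\<close> yields
  \<open>g b a \<le> g b x\<close>. Only transitivity is asked of \<open>g\<close>, so that it may
  come from an arbitrary transitive multiset.\<close>

lemma rot_least:
  assumes trans: "\<And>x y z. x < y \<Longrightarrow> y < z \<Longrightarrow> g y x = 0 \<or> g z y \<le> (g z x :: nat)"
    and le: "\<And>y x. f y x \<le> g y x" and less: "f b a < g b a"
  shows "rot f a b y x \<le> g y x"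
proof (cases "y = b \<and> x \<in> block f a")
  case True
  have "g b a \<le> g b x"
  proof (cases "x = a")
    case False
    then have "x < a" "0 < g a x"
      using True le[of a x] by (auto simp: block_def)
    with trans[of x a b] ascent_bounds show ?thesis by auto
  qed simp
  with True less show ?thesis by (simp add: rot_def)
qed (use le in \<open>auto simp: rot_def\<close>)

end

text \<open>The last row in which two comparable functions differ contains an ascent: take the last
  entry of that row in which they differ.\<close>

lemma ascent_below:
  assumes g: "tamari_function n s g" and le: "\<And>y x. f y x \<le> g y x" and ne: "f \<noteq> g"
  obtains a b where "ascent n s f a b" "f b a < g b a"
proof -
  define R where "R = {b. \<exists>a. f b a < g b a}"
  have pos: "1 \<le> x \<and> x < y \<and> y \<le> n" if "0 < g y x" for x y
    using g that unfolding tamari_function_def inversion_pairs_def by fastforce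
  have "R \<subseteq> {..n}" using pos by (auto simp: R_def) (metis gr0I not_less0)
  then have finR: "finite R" by (rule finite_subset) simp
  have "R \<noteq> {}"
    using ne le by (auto simp: R_def fun_eq_iff) (metis le_neq_implies_less)
  define b where "b = Max R"
  have bR: "b \<in> R" and bmax: "\<And>y. y \<in> R \<Longrightarrow> y \<le> b"
    using finR \<open>R \<noteq> {}\<close> by (auto simp: b_def)
  define C where "C = {a. f b a < g b a}"
  have "C \<subseteq> {..n}" using pos[of b] by (auto simp: C_def) (metis gr0I not_less0 less_imp_le order.trans)
  then have finC: "finite C" by (rule finite_subset) simp
  have "C \<noteq> {}" using bR by (auto simp: C_def R_def)
  define a where "a = Max C"
  have aC: "f b a < g b a" and amax: "\<And>y. f b y < g b y \<Longrightarrow> y \<le> a"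
    using finC \<open>C \<noteq> {}\<close> Max_in[of C] by (auto simp: a_def C_def)
  have bnd: "1 \<le> a" "a < b" "b \<le> n" using aC pos[of b a] by auto
  have "ascent n s f a b"
    unfolding ascent_def
  proof (intro conjI allI impI bnd)
    have "g b a \<le> s b" using g by (simp add: tamari_function_def)
    with aC show "f b a < s b" by simp
  next
    fix x assume x: "a < x \<and> x < b"
    then have "\<not> f b x < g b x" using amax by (meson not_le)
    moreover have "g b a \<le> g b x" using g x bnd by (auto simp: tamari_function_def)
    ultimately show "f b a < f b x" using aC by linarith
  next
    fix z assume z: "b < z"
    then have "z \<notin> R" using bmax by (meson not_le)
    then have "f z x = g z x" for x
      using le[of z x] by (auto simp: R_def) (metis le_neq_implies_less)
    \<comment> \<open>Rows after \<open>b\<close> are common to \<open>f\<close> and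
      \<open>g\<close>, and in \<open>g\<close> the positive entry \<open>(b, a)\<close> forces this
      equality.\<close>
    moreover have "g z a = g z b"
    proof -
      have "g b a = 0 \<or> g z b \<le> g z a" "g z a \<le> g z b"
        using g z bnd by (auto simp: tamari_function_def)
      with aC show ?thesis by simp
    qed
    ultimately show "f z a = f z b" by simp
  qed
  with aC that show ?thesis by blast
qed

text \<open>Each rotation raises its own entry, so the other one must raise it as well. Then
  \<open>a\<close> and \<open>a'\<close> lie in each other's blocks, whose largest elements are
  \<open>a'\<close> and \<open>a\<close>.\<close>

lemma rot_inject:
  assumes "ascent n s f a b" "ascent n s f a' b'" "rot f a b = rot f a' b'"
  shows "a = a' \<and> b = b'"
proof -
  have "rot f a b b a = Suc (f b a)" "rot f a' b' b' a' = Suc (f b' a')"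
    by (simp_all add: rot_def block_def)
  then have "rot f a' b' b a \<noteq> f b a" "rot f a b b' a' \<noteq> f b' a'"
    using assms(3) by auto
  then have "b = b' \<and> a \<in> block f a'" "a' \<in> block f a"
    by (auto simp: rot_def split: if_splits)
  then show ?thesis using block_le[of a a'] block_le[of a' a] by simp
qed

text \<open>If \<open>b < b'\<close>, the first ascent gives \<open>f b' a = f b' b\<close> and the
  second \<open>f b' a < f b' b\<close>. This is why distinct covers of an element get distinct
  labels.\<close>

lemma ascent_unique_parent:
  assumes "ascent n s f a b" "ascent n s f a b'"
  shows "b = b'"
  using assms unfolding ascent_def by (metis linorder_neqE_nat less_irrefl)

end

text \<open>Two ascents, listed by row and then by column.  Performing the two rotations one after the
  other gives an upper bound of both, and the labels occurring below that bound can be read off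
  from the entries in which it differs from \<open>f\<close>.\<close>

locale two_ascents =
  fixes n :: nat and s :: "nat \<Rightarrow> nat" and f :: "nat \<Rightarrow> nat \<Rightarrow> nat" and a b a' b' :: nat
  assumes f: "tamari_function n s f"
    and ascent1: "ascent n s f a b" and ascent2: "ascent n s f a' b'"
    and lex: "b < b' \<or> b = b' \<and> a < a'"
begin

definition g where "g = rot f a b"

definition J where "J = rot g a' b'"

lemma neq: "a \<noteq> a'"
  using lex ascent_unique_parent[OF f ascent1] ascent2 by auto

lemma g: "tamari_function n s g"
  unfolding g_def by (rule tamari_function_rot[OF f ascent1])

lemma g_other: "y \<noteq> b \<or> a < x \<Longrightarrow> g y x = f y x"
  using block_le[OF f, of x a] by (auto simp: g_def rot_def)

text \<open>An ascent in row \<open>b'\<close> is tested on the columns from \<open>a'\<close> on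
  and on later rows. By \<open>lex\<close> the first rotation changes none of these entries.\<close>

lemma ascent_g: "ascent n s g a' b'"
proof -
  have "g b' x = f b' x" if "a' \<le> x" for x using lex that by (intro g_other) auto
  moreover have "g z x = f z x" if "b' < z" for z x using lex that by (intro g_other) auto
  ultimately show ?thesis using ascent2 by (auto simp: ascent_def)
qed

lemma J: "tamari_function n s J"
  unfolding J_def by (rule tamari_function_rot[OF g ascent_g])

lemma f_le_g: "f y x \<le> g y x"
  unfolding g_def by (rule rot_ge[OF f ascent1])

lemma g_le_J: "g y x \<le> J y x"
  unfolding J_def by (rule rot_ge[OF g ascent_g])

text \<open>\<open>J\<close> was built on top of the first rotation only; it lies above the second
  one by minimality, being transitive, above \<open>f\<close>, and larger than \<open>f\<close> at
  \<open>(b', a')\<close>.\<close>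

lemma rot2_le_J: "rot f a' b' y x \<le> J y x"
proof (rule rot_least[OF f ascent2])
  show "J y x = 0 \<or> J z y \<le> J z x" if "x < y" "y < z" for x y z
    using J that by (simp add: tamari_function_def)
  show "f y x \<le> J y x" for y x using f_le_g g_le_J order.trans by blast
  have "f b' a' \<le> g b' a'" by (rule f_le_g)
  then show "f b' a' < J b' a'" by (simp add: J_def rot_def block_def)
qed

text \<open>The second block is taken in \<open>g\<close>, since the first rotation may enlarge it
  when \<open>a' = b\<close>.\<close>

lemma differ_cases:
  assumes "f y x < J y x"
  shows "y = b \<and> x \<in> block f a \<or> y = b' \<and> x \<in> block g a'"
  using assms by (auto simp: J_def g_def rot_def split: if_splits)

text \<open>Here \<open>p\<close> stands for a member of a saturated chain from \<open>f\<close> to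
  an element below \<open>J\<close>, and \<open>(c, d)\<close> for the ascent along which the chain
  continues.\<close>

context
  fixes p q and c d
  assumes p: "tamari_function n s p" and fp: "\<And>y x. f y x \<le> p y x"
    and cd: "ascent n s p c d" and rot_le: "\<And>y x. rot p c d y x \<le> J y x"
begin

lemma differ: "f d c < J d c"
proof -
  have "f d c < rot p c d d c" using fp[of d c] by (simp add: rot_def block_def)
  also have "\<dots> \<le> J d c" by (rule rot_le)
  finally show ?thesis .
qed

lemma no_inversion: "c < y \<Longrightarrow> y < d \<Longrightarrow> f y c = 0"
  using fp[of y c] ascent_zero[OF p cd] by simp

text \<open>The entry \<open>(d, c)\<close> lies in one of the two raised blocks. In the first,
  \<open>c \<noteq> a\<close> would mean \<open>0 < f a c\<close> with \<open>c < a < d\<close>,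
  contrary to \<open>no_inversion\<close>. In the second, if \<open>c \<noteq> a'\<close>, then
  \<open>g a' c\<close> is positive while \<open>f a' c = 0\<close>; so the first rotation created
  it, whence \<open>a' = b\<close> and \<open>c\<close> is in \<open>block f a\<close>, and the
  first argument leaves only \<open>c = a\<close>.\<close>

lemma label_cases: "c = a \<or> c = a'"
  using differ_cases[OF differ]
proof
  assume d: "d = b \<and> c \<in> block f a"
  then show ?thesis
    using no_inversion[of a] ascent_bounds[OF f ascent1] by (auto simp: block_def)
next
  assume d: "d = b' \<and> c \<in> block g a'"
  show ?thesis
  proof (cases "c = a'")
    case False
    then have c: "c < a'" "0 < g a' c" using d by (auto simp: block_def)
    have "f a' c = 0" using no_inversion c d ascent_bounds[OF f ascent2] by simp
    with c have "a' = b" "c \<in> block f a" by (auto simp: g_def rot_def split: if_splits)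
    then show ?thesis
      using no_inversion[of a] d ascent_bounds[OF f ascent1] ascent_bounds[OF f ascent2]
      by (auto simp: block_def)
  qed simp
qed

text \<open>A step with label \<open>a'\<close> raising \<open>(b, a)\<close> needs
  \<open>d = b\<close> and \<open>0 < p a' a\<close>, with \<open>a < a' < b\<close>. But
  \<open>f a' a = 0\<close>, so row \<open>a'\<close> must have been changed on the way to
  \<open>J\<close>, although \<open>a'\<close> is neither \<open>b\<close> nor
  \<open>b'\<close>.\<close>

lemma label_of_first:
  assumes "p b a < rot p c d b a"
  shows "c = a"
proof (rule ccontr)
  assume "c \<noteq> a"
  then have c: "c = a'" using label_cases by simp
  have d: "d = b" "a \<in> block p a'" using assms c by (auto simp: rot_def split: if_splits)
  then have aa': "a < a'" "0 < p a' a" using neq by (auto simp: block_def)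
  have "p a' a \<le> J a' a" using rot_ge[OF p cd] rot_le order.trans by blast
  then have J: "0 < J a' a" using aa' by simp
  have a'b: "a' < b" using ascent_bounds[OF p cd] c d by simp
  then have "f a' a = 0" using ascent_zero[OF f ascent1] aa' by simp
  with J differ_cases[of a' a] have "a' = b \<or> a' = b'" by auto
  with a'b ascent_bounds[OF f ascent2] show False by auto
qed

text \<open>A step with label \<open>a\<close> raising \<open>(b', a')\<close> needs
  \<open>d = b'\<close> and \<open>a' < a\<close>, hence \<open>b < b'\<close> by
  \<open>lex\<close>. Then \<open>(b', a)\<close> can be raised only by the second rotation, whose
  block ends at \<open>a' < a\<close>.\<close>

lemma label_of_second:
  assumes "p b' a' < rot p c d b' a'"
  shows "c = a'"
proof (rule ccontr)
  assume "c \<noteq> a'"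
  then have c: "c = a" using label_cases by simp
  have d: "d = b'" "a' \<in> block p a" using assms c by (auto simp: rot_def split: if_splits)
  then have a'a: "a' < a" using neq by (auto simp: block_def)
  then have "b < b'" using lex by auto
  then have "a \<in> block g a'" using differ_cases[OF differ] c d by auto
  then show False using a'a by (auto simp: block_def)
qed

end

end

section \<open>Pointwise infima and the greatest function\<close>

lemma tamari_function_inf:
  assumes "S \<noteq> {}" and S: "\<And>f. f \<in> S \<Longrightarrow> tamari_function n s f"
  shows "tamari_function n s (\<lambda>y x. INF f\<in>S. f y x)"
proof -
  have le: "(INF f\<in>S. f y x) \<le> h y x" if "h \<in> S" for h y x
    using that by (intro cINF_lower) auto
  have ge: "m \<le> (INF f\<in>S. f y x)" if "\<And>h. h \<in> S \<Longrightarrow> m \<le> h y x" for m :: nat and y x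
    using that assms(1) by (intro cINF_greatest) auto
  obtain h where h: "h \<in> S" using assms(1) by auto
  show ?thesis
    unfolding tamari_function_def
  proof (intro conjI allI impI)
    fix x y
    show "(INF f\<in>S. f y x) \<le> s y"
      using le[OF h, of y x] S[OF h] by (auto simp: tamari_function_def intro: order.trans)
    show "(INF f\<in>S. f y x) = 0" if "(y, x) \<notin> inversion_pairs n"
      using le[OF h, of y x] S[OF h] that by (auto simp: tamari_function_def)
  next
    fix x y z :: nat assume "1 \<le> x \<and> x < y \<and> y < z"
    then have "h z x \<le> h z y" if "h \<in> S" for h
      using S[OF that] by (simp add: tamari_function_def)
    then show "(INF f\<in>S. f z x) \<le> (INF f\<in>S. f z y)"
      by (intro ge) (rule order.trans[OF le])
  next
    fix x y z :: nat assume xyz: "x < y \<and> y < z"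
    show "(INF f\<in>S. f y x) = 0 \<or> (INF f\<in>S. f z y) \<le> (INF f\<in>S. f z x)"
    \<comment> \<open>One member vanishing at \<open>(y, x)\<close> makes the infimum vanish there;
      if none does, all members satisfy the inequality.\<close>
    proof (cases "\<exists>h\<in>S. h y x = 0")
      case True
      then show ?thesis using le by (metis le_zero_eq)
    next
      case False
      then have "h z y \<le> h z x" if "h \<in> S" for h
        using S[OF that] that xyz by (metis tamari_function_def)
      then show ?thesis by (intro disjI2 ge) (rule order.trans[OF le])
    qed
  qed
qed

lemma tamari_function_top:
  "tamari_function n s (\<lambda>y x. if (y, x) \<in> inversion_pairs n then s y else 0)"
  by (auto simp: tamari_function_def inversion_pairs_def)

section \<open>The s-Tamari lattice in terms of functions\<close>

definition inv_fun :: "nat \<Rightarrow> (nat \<Rightarrow> nat) \<Rightarrow> ltree \<Rightarrow> nat \<Rightarrow> nat \<Rightarrow> nat" where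
  "inv_fun n s T = (\<lambda>y x. count (tree_inv n s T) (y, x))"

lemma inv_fun_eq:
  "inv_fun n s T y x = (if (y, x) \<in> inversion_pairs n then tree_card s T y x else 0)"
proof -
  have "inversion_pairs n \<subseteq> {..n} \<times> {..n}" by (auto simp: inversion_pairs_def)
  then have fin: "finite (inversion_pairs n)" by (rule finite_subset) simp
  have "inv_fun n s T y x =
      (\<Sum>q\<in>inversion_pairs n. if q = (y, x) then tree_card s T y x else 0)"
    unfolding inv_fun_def tree_inv_def count_sum by (intro sum.cong) (auto split: if_splits)
  then show ?thesis using fin by (simp add: sum.delta)
qed

lemma set_tree_inv: "set_mset (tree_inv n s T) \<subseteq> inversion_pairs n"
proof
  fix q assume "q \<in># tree_inv n s T"
  then have "inv_fun n s T (fst q) (snd q) \<noteq> 0" by (simp add: inv_fun_def)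
  then show "q \<in> inversion_pairs n" by (auto simp: inv_fun_eq split: if_splits)
qed

lemma tree_inv_subset_iff:
  "tree_inv n s T \<subseteq># tree_inv n s Z \<longleftrightarrow> (\<forall>y x. inv_fun n s T y x \<le> inv_fun n s Z y x)"
  by (simp add: subseteq_mset_def inv_fun_def)

lemma tree_inv_eq_iff: "tree_inv n s T = tree_inv n s Z \<longleftrightarrow> inv_fun n s T = inv_fun n s Z"
  by (auto simp: multiset_eq_iff inv_fun_def fun_eq_iff)

lemma tamari_function_inv_fun:
  assumes "s_tamari_tree n s T"
  shows "tamari_function n s (inv_fun n s T)"
proof -
  have T: "decreasing_ltree s T" "set (labels T) = {1..n}"
    and mono: "\<And>a b c. 1 \<le> a \<Longrightarrow> a < b \<Longrightarrow> b < c \<Longrightarrow> c \<le> n \<Longrightarrow> tree_card s T c a \<le> tree_card s T c b"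
    using assms by (auto simp: s_tamari_tree_def s_decreasing_tree_iff)
  show ?thesis
    unfolding tamari_function_def
  proof (intro conjI allI impI)
    show "inv_fun n s T y x \<le> s y" for x y
      using tree_card_le[OF T(1), of x y] T(2) by (auto simp: inv_fun_eq inversion_pairs_def)
    show "inv_fun n s T y x = 0" if "(y, x) \<notin> inversion_pairs n" for x y
      using that by (simp add: inv_fun_eq)
    show "inv_fun n s T c a \<le> inv_fun n s T c b" if "1 \<le> a \<and> a < b \<and> b < c" for a b c
      using that mono by (auto simp: inv_fun_eq inversion_pairs_def)
    show "inv_fun n s T b a = 0 \<or> inv_fun n s T c b \<le> inv_fun n s T c a"
      if "a < b \<and> b < c" for a b c
      using that tree_card_transitive[OF T(1), of a b c] T(2)
      by (auto simp: inv_fun_eq inversion_pairs_def)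
  qed
qed

lemma inv_fun_inject:
  assumes "s_tamari_tree n s T" "s_tamari_tree n s Z" "inv_fun n s T = inv_fun n s Z"
  shows "T = Z"
proof (rule tree_card_inj)
  show "decreasing_ltree s T" "decreasing_ltree s Z" "set (labels T) = set (labels Z)"
    using assms by (auto simp: s_tamari_tree_def s_decreasing_tree_iff)
  fix x y assume "x \<in> set (labels T)" "y \<in> set (labels T)" "x < y"
  then have "(y, x) \<in> inversion_pairs n"
    using assms by (auto simp: s_tamari_tree_def s_decreasing_tree_iff inversion_pairs_def)
  then show "tree_card s T y x = tree_card s Z y x"
    using assms(3) by (metis inv_fun_eq)
qed

lemma inv_fun_surj:
  assumes f: "tamari_function n s f"
  obtains T where "s_tamari_tree n s T" "inv_fun n s T = f"
proof -
  have "\<exists>T. decreasing_ltree s T \<and> set (labels T) = {1..n} \<and>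
          (\<forall>x\<in>{1..n}. \<forall>y\<in>{1..n}. x < y \<longrightarrow> tree_card s T y x = f y x)"
    using f by (intro tree_card_surj) (auto simp: tamari_function_def)
  then obtain T where T: "decreasing_ltree s T" "set (labels T) = {1..n}"
    and eq: "\<And>x y. 1 \<le> x \<Longrightarrow> x < y \<Longrightarrow> y \<le> n \<Longrightarrow> tree_card s T y x = f y x"
    by fastforce
  have "inv_fun n s T y x = f y x" for y x
    using f eq by (auto simp: inv_fun_eq tamari_function_def inversion_pairs_def)
  then have "inv_fun n s T = f" by (intro ext)
  moreover have "s_tamari_tree n s T"
    using f T eq by (auto simp: s_tamari_tree_def s_decreasing_tree_iff tamari_function_def)
  ultimately show ?thesis using that by blast
qed

lemma tamari_ascent_iff:
  assumes "s_tamari_tree n s T"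
  shows "tamari_ascent s T a b \<longleftrightarrow> ascent n s (inv_fun n s T) a b"
proof -
  have T: "decreasing_ltree s T" "set (labels T) = {1..n}"
    and mono: "\<And>a b c. 1 \<le> a \<Longrightarrow> a < b \<Longrightarrow> b < c \<Longrightarrow> c \<le> n \<Longrightarrow> tree_card s T c a \<le> tree_card s T c b"
    using assms by (auto simp: s_tamari_tree_def s_decreasing_tree_iff)
  show ?thesis
  proof (cases "1 \<le> a \<and> a < b \<and> b \<le> n")
    case True
    have "child_of T a b \<longleftrightarrow>
       (\<forall>x\<in>{1..n}. a < x \<and> x < b \<longrightarrow> tree_card s T b a < tree_card s T b x) \<and>
       (\<forall>z\<in>{1..n}. b < z \<longrightarrow> tree_card s T z a = tree_card s T z b)"
      unfolding T(2)[symmetric] using True mono T by (intro child_of_iff) auto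
    also have "\<dots> \<longleftrightarrow>
       (\<forall>x. a < x \<and> x < b \<longrightarrow> inv_fun n s T b a < inv_fun n s T b x) \<and>
       (\<forall>z>b. inv_fun n s T z a = inv_fun n s T z b)"
      using True by (auto simp: inv_fun_eq inversion_pairs_def)
    finally show ?thesis
      using True unfolding tamari_ascent_def ascent_def
      by (auto simp: inv_fun_eq inversion_pairs_def)
  next
    case False
    then show ?thesis
      using child_of_labels[of T a b] T(2) by (auto simp: tamari_ascent_def ascent_def)
  qed
qed

section \<open>Rotations and labels of trees\<close>

lemma is_transitive_closure_unique:
  "is_transitive_closure n I J \<Longrightarrow> is_transitive_closure n I K \<Longrightarrow> J = K"
  by (auto simp: is_transitive_closure_def intro: subset_mset.antisym)

text \<open>The rotated function is transitive and contains the enlarged multiset, and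
  \<open>rot_least\<close> makes it the least such. Some tree \<open>Y\<close> realizes it, and
  uniqueness of the closure identifies \<open>Z\<close> with that tree's inversions.\<close>

lemma is_tamari_rotation_iff:
  assumes T: "s_tamari_tree n s T" and Z: "s_tamari_tree n s Z"
    and ab: "ascent n s (inv_fun n s T) a b"
  shows "is_tamari_rotation n s T a b Z \<longleftrightarrow> inv_fun n s Z = rot (inv_fun n s T) a b"
proof -
  let ?f = "inv_fun n s T"
  let ?I = "add_inversion s (tree_inv n s T) b a"
  have f: "tamari_function n s ?f" using T by (rule tamari_function_inv_fun)
  \<comment> \<open>The cap in \<open>add_inversion\<close> is not reached, because an ascent has
    \<open>f b a < s b\<close>.\<close>
  have I: "count ?I (y, x) = (if y = b \<and> x = a then Suc (?f b a) else ?f y x)" for x y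
    using ascent_bounds(4)[OF f ab] by (auto simp: add_inversion_def inv_fun_def)
  have closure: "is_transitive_closure n ?I (tree_inv n s Y)"
    if Y: "s_tamari_tree n s Y" and eq: "inv_fun n s Y = rot ?f a b" for Y
    unfolding is_transitive_closure_def
  proof (intro conjI allI impI)
    show "set_mset (tree_inv n s Y) \<subseteq> inversion_pairs n" by (rule set_tree_inv)
    show "mset_transitive (tree_inv n s Y)"
      using tamari_function_inv_fun[OF Y]
      by (auto simp: mset_transitive_def tamari_function_def inv_fun_def)
    have rot_at: "rot ?f a b b a = Suc (?f b a)" by (simp add: rot_def block_def)
    show "?I \<subseteq># tree_inv n s Y"
      unfolding subseteq_mset_def
    proof
      fix q :: "nat \<times> nat"
      obtain y x where q: "q = (y, x)" by fastforce
      have "count (tree_inv n s Y) (y, x) = rot ?f a b y x"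
        unfolding eq[symmetric] by (simp add: inv_fun_def)
      then show "count ?I q \<le> count (tree_inv n s Y) q"
        unfolding q I using rot_ge[OF f ab, of y x] rot_at by simp
    qed
    fix K assume K: "set_mset K \<subseteq> inversion_pairs n \<and> mset_transitive K \<and> ?I \<subseteq># K"
    then have IK: "(if y = b \<and> x = a then Suc (?f b a) else ?f y x) \<le> count K (y, x)" for x y
      unfolding I[symmetric] by (simp add: subseteq_mset_def)
    have "rot ?f a b y x \<le> count K (y, x)" for y x
    proof (rule rot_least[OF f ab, where g = "\<lambda>y x. count K (y, x)"])
      show "count K (y, x) = 0 \<or> count K (z, y) \<le> count K (z, x)" if "x < y" "y < z" for x y z
        using K that by (auto simp: mset_transitive_def)
      show "?f y x \<le> count K (y, x)" for y x
        using IK[of y x] by (auto split: if_splits)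
      show "?f b a < count K (b, a)" using IK[of b a] by simp
    qed
    then show "tree_inv n s Y \<subseteq># K"
      unfolding eq[symmetric] by (auto simp: subseteq_mset_def inv_fun_def)
  qed
  obtain Y where Y: "s_tamari_tree n s Y" "inv_fun n s Y = rot ?f a b"
    using inv_fun_surj[OF tamari_function_rot[OF f ab]] .
  show ?thesis
  proof
    assume "is_tamari_rotation n s T a b Z"
    then have "tree_inv n s Z = tree_inv n s Y"
      using closure[OF Y] is_transitive_closure_unique by (auto simp: is_tamari_rotation_def)
    with Y(2) show "inv_fun n s Z = rot ?f a b" by (simp add: tree_inv_eq_iff)
  next
    assume "inv_fun n s Z = rot ?f a b"
    with closure[OF Z] Z show "is_tamari_rotation n s T a b Z"
      by (simp add: is_tamari_rotation_def)
  qed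
qed

lemma tamari_label_rot:
  assumes "s_tamari_tree n s T" "s_tamari_tree n s Z"
    and "ascent n s (inv_fun n s T) a b" "inv_fun n s Z = rot (inv_fun n s T) a b"
  shows "tamari_label n s T Z = a"
proof -
  have "(THE (a, b). tamari_ascent s T a b \<and> is_tamari_rotation n s T a b Z) = (a, b)"
  proof (rule the_equality)
    show "case (a, b) of (a, b) \<Rightarrow> tamari_ascent s T a b \<and> is_tamari_rotation n s T a b Z"
      using assms by (simp add: tamari_ascent_iff is_tamari_rotation_iff)
    fix q assume q: "case q of (a, b) \<Rightarrow> tamari_ascent s T a b \<and> is_tamari_rotation n s T a b Z"
    obtain a' b' where "q = (a', b')" by fastforce
    with q assms rot_inject[OF tamari_function_inv_fun[OF assms(1)], of a b a' b']
    show "q = (a, b)" by (auto simp: tamari_ascent_iff is_tamari_rotation_iff)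
  qed
  then show ?thesis by (simp add: tamari_label_def)
qed

section \<open>Order, finiteness and lattice structure\<close>

lemma carrier_s_tamari [simp]: "T \<in> carrier (s_tamari n s) \<longleftrightarrow> s_tamari_tree n s T"
  by (simp add: s_tamari_def)

lemma le_s_tamari [simp]:
  "T \<sqsubseteq>\<^bsub>s_tamari n s\<^esub> Z \<longleftrightarrow> (\<forall>y x. inv_fun n s T y x \<le> inv_fun n s Z y x)"
  by (simp add: s_tamari_def tree_inv_subset_iff)

lemma lless_s_tamari:
  "T \<sqsubset>\<^bsub>s_tamari n s\<^esub> Z \<longleftrightarrow> (\<forall>y x. inv_fun n s T y x \<le> inv_fun n s Z y x) \<and> T \<noteq> Z"
  by (simp add: lless_def) (simp add: s_tamari_def)

text \<open>A tree is determined by its entries with indices at most \<open>n\<close>, all bounded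
  by \<open>M\<close>. Restricting the functions to these indices embeds the carrier into a finite
  set of extensional functions.\<close>

lemma finite_s_tamari: "finite (carrier (s_tamari n s))"
proof -
  define M where "M = Max (s ` {..n})"
  define R where "R = PiE {..n} (\<lambda>_. PiE {..n} (\<lambda>_. {..M}))"
  let ?r = "\<lambda>T. restrict (\<lambda>y. restrict (inv_fun n s T y) {..n}) {..n}"
  have "finite R" unfolding R_def by (intro finite_PiE) auto
  moreover have "?r ` carrier (s_tamari n s) \<subseteq> R"
  proof (rule image_subsetI)
    fix T assume "T \<in> carrier (s_tamari n s)"
    then have "tamari_function n s (inv_fun n s T)" by (simp add: tamari_function_inv_fun)
    then have "inv_fun n s T y x \<le> s y" for y x by (simp add: tamari_function_def)
    moreover have "s y \<le> M" if "y \<le> n" for y using that by (simp add: M_def)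
    ultimately have "inv_fun n s T y x \<le> M" if "y \<le> n" for y x using that order.trans by blast
    then show "?r T \<in> R" by (auto simp: R_def)
  qed
  moreover have "inj_on ?r (carrier (s_tamari n s))"
  proof (rule inj_onI)
    fix T Z assume TZ: "T \<in> carrier (s_tamari n s)" "Z \<in> carrier (s_tamari n s)" "?r T = ?r Z"
    have "inv_fun n s T y x = inv_fun n s Z y x" for y x
    proof (cases "(y, x) \<in> inversion_pairs n")
      case True
      then have "y \<le> n" "x \<le> n" by (auto simp: inversion_pairs_def)
      then show ?thesis using fun_cong[OF fun_cong[OF TZ(3)], of y x] by simp
    qed (simp add: inv_fun_eq)
    then have "inv_fun n s T = inv_fun n s Z" by (intro ext)
    with TZ(1,2) show "T = Z" unfolding carrier_s_tamari by (rule inv_fun_inject)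
  qed
  ultimately show ?thesis by (metis finite_imageD finite_subset)
qed

lemma eq_s_tamari [simp]: "eq (s_tamari n s) = (=)"
  by (simp add: s_tamari_def)

lemma partial_order_s_tamari: "partial_order (s_tamari n s)"
proof unfold_locales
  show "x .=\<^bsub>s_tamari n s\<^esub> y" if "x \<sqsubseteq>\<^bsub>s_tamari n s\<^esub> y" "y \<sqsubseteq>\<^bsub>s_tamari n s\<^esub> x"
    "x \<in> carrier (s_tamari n s)" "y \<in> carrier (s_tamari n s)" for x y
  proof -
    have "inv_fun n s x = inv_fun n s y" using that(1,2) by (intro ext antisym) auto
    with that inv_fun_inject show ?thesis by simp
  qed
  show "x \<sqsubseteq>\<^bsub>s_tamari n s\<^esub> z" if "x \<sqsubseteq>\<^bsub>s_tamari n s\<^esub> y" "y \<sqsubseteq>\<^bsub>s_tamari n s\<^esub> z" for x y z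
    using that unfolding le_s_tamari by (meson order.trans)
qed simp_all

lemma greatest_lower_bound_s_tamari:
  assumes "S \<subseteq> carrier (s_tamari n s)" "S \<noteq> {}"
  obtains M where "greatest (s_tamari n s) M (Lower (s_tamari n s) S)"
proof -
  have "tamari_function n s (\<lambda>y x. INF f\<in>inv_fun n s ` S. f y x)"
    using assms by (intro tamari_function_inf) (auto intro!: tamari_function_inv_fun)
  then obtain M where M: "s_tamari_tree n s M"
    "inv_fun n s M = (\<lambda>y x. INF f\<in>inv_fun n s ` S. f y x)"
    by (rule inv_fun_surj)
  then have eq: "inv_fun n s M y x = (INF T\<in>S. inv_fun n s T y x)" for y x
    by (simp add: image_comp)
  have "greatest (s_tamari n s) M (Lower (s_tamari n s) S)"
    unfolding greatest_def Lower_def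
    using assms M(1) by (auto simp: eq intro!: cINF_lower cINF_greatest)
  with that show ?thesis .
qed

text \<open>Meets are pointwise infima. A join is the meet of all common upper bounds, a nonempty
  set because it contains the greatest tree \<open>U\<close>.\<close>

lemma lattice_s_tamari: "lattice (s_tamari n s)"
proof -
  interpret partial_order "s_tamari n s" by (rule partial_order_s_tamari)
  let ?L = "s_tamari n s"
  obtain U where U: "s_tamari_tree n s U"
    "inv_fun n s U = (\<lambda>y x. if (y, x) \<in> inversion_pairs n then s y else 0)"
    using inv_fun_surj[OF tamari_function_top] .
  have top: "T \<sqsubseteq>\<^bsub>?L\<^esub> U" if "T \<in> carrier ?L" for T
    using that tamari_function_inv_fun[of n s T] by (auto simp: U(2) tamari_function_def)
  show ?thesis
  proof unfold_locales
    fix T Z assume TZ: "T \<in> carrier ?L" "Z \<in> carrier ?L"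
    show "\<exists>M. greatest ?L M (Lower ?L {T, Z})"
      using greatest_lower_bound_s_tamari[of "{T, Z}"] TZ by blast
    let ?S = "Upper ?L {T, Z}"
    have "U \<in> ?S" using TZ U(1) top by (auto simp: Upper_def simp del: le_s_tamari)
    then have "?S \<noteq> {}" by auto
    then obtain M where M: "greatest ?L M (Lower ?L ?S)"
      by (rule greatest_lower_bound_s_tamari[OF Upper_closed])
    have "least ?L M ?S"
    proof (rule least_UpperI)
      show "M \<in> carrier ?L" using M by (rule greatest_closed)
      show "X \<sqsubseteq>\<^bsub>?L\<^esub> M" if "X \<in> {T, Z}" for X
        using that TZ by (intro greatest_le[OF M]) (auto simp: Lower_def Upper_def simp del: le_s_tamari)
      show "M \<sqsubseteq>\<^bsub>?L\<^esub> Y" if "Y \<in> ?S" for Y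
        by (rule greatest_Lower_below[OF M that Upper_closed])
    qed (use TZ in simp)
    then show "\<exists>M. least ?L M ?S" by blast
  qed
qed

text \<open>By \<open>ascent_below\<close> some rotation \<open>Y\<close> of \<open>T\<close> stays
  below \<open>Z\<close>. It lies strictly above \<open>T\<close>, so the cover relation forces
  \<open>Y = Z\<close>.\<close>

lemma covers_s_tamari:
  assumes "covers (s_tamari n s) T Z"
  obtains a b where "s_tamari_tree n s T" "s_tamari_tree n s Z"
    "ascent n s (inv_fun n s T) a b" "inv_fun n s Z = rot (inv_fun n s T) a b"
    "tamari_label n s T Z = a"
proof -
  let ?L = "s_tamari n s" and ?F = "inv_fun n s"
  have T: "s_tamari_tree n s T" and Z: "s_tamari_tree n s Z"
    and le: "\<And>y x. ?F T y x \<le> ?F Z y x" and ne: "T \<noteq> Z"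
    using assms unfolding covers_def carrier_s_tamari by (auto simp: lless_s_tamari)
  have nb: "\<not> (T \<sqsubset>\<^bsub>?L\<^esub> Y \<and> Y \<sqsubset>\<^bsub>?L\<^esub> Z)" if "s_tamari_tree n s Y" for Y
    using assms that unfolding covers_def by (meson carrier_s_tamari)
  note f = tamari_function_inv_fun[OF T] and g = tamari_function_inv_fun[OF Z]
  have "?F T \<noteq> ?F Z" using inv_fun_inject[OF T Z] ne by blast
  then obtain a b where ab: "ascent n s (?F T) a b" "?F T b a < ?F Z b a"
    using ascent_below[OF f g le] by blast
  obtain Y where Y: "s_tamari_tree n s Y" "?F Y = rot (?F T) a b"
    using inv_fun_surj[OF tamari_function_rot[OF f ab(1)]] .
  have "?F Y b a \<noteq> ?F T b a" by (simp add: Y(2) rot_def block_def)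
  then have "T \<noteq> Y" by auto
  then have "T \<sqsubset>\<^bsub>?L\<^esub> Y" using rot_ge[OF f ab(1)] by (auto simp: lless_s_tamari Y(2))
  then have "\<not> Y \<sqsubset>\<^bsub>?L\<^esub> Z" using nb Y(1) by blast
  moreover have "?F Y y x \<le> ?F Z y x" for y x
    unfolding Y(2)
  proof (rule rot_least[OF f ab(1)])
    show "?F Z y x = 0 \<or> ?F Z z y \<le> ?F Z z x" if "x < y" "y < z" for x y z
      using g that by (simp add: tamari_function_def)
  qed (use le ab(2) in simp_all)
  ultimately have "Y = Z" by (auto simp: lless_s_tamari)
  with Y(2) have "?F Z = rot (?F T) a b" by simp
  with that[OF T Z ab(1)] tamari_label_rot[OF T Z ab(1)] show ?thesis by simp
qed

section \<open>Labels along saturated chains\<close>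

lemma step_increase:
  fixes h :: "nat \<Rightarrow> nat"
  assumes "h 0 < h m"
  shows "\<exists>i<m. h i < h (Suc i)"
proof (rule ccontr)
  assume "\<not> (\<exists>i<m. h i < h (Suc i))"
  then have "h (Suc k) \<le> h k" if "k < m" for k using that by (meson not_le)
  then have "h k \<le> h 0" if "k \<le> m" for k
    using that by (induction k) (simp, metis Suc_le_eq Suc_leD order.trans)
  with assms show False by (meson leD order.refl)
qed

text \<open>The join lies below the tree \<open>k\<close> encoding \<open>J\<close>, so every step
  of the chain takes place between \<open>F u\<close> and \<open>J\<close>, where
  \<open>label_cases\<close> allows only the two labels. Both occur: the join is above
  \<open>v\<close> and \<open>w\<close>, so the entries \<open>(b, a)\<close> and
  \<open>(b', a')\<close> must rise at some step, and \<open>label_of_first\<close> and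
  \<open>label_of_second\<close> name the label of that step.\<close>

lemma chain_labels_two_ascents:
  fixes n s and u v w :: ltree
  defines "L \<equiv> s_tamari n s" and "F \<equiv> inv_fun n s"
  assumes u: "s_tamari_tree n s u" and v: "s_tamari_tree n s v" and w: "s_tamari_tree n s w"
    and tw: "two_ascents n s (F u) a b a' b'"
    and Fv: "F v = rot (F u) a b" and Fw: "F w = rot (F u) a' b'"
    and chain: "saturated_chain L u (v \<squnion>\<^bsub>L\<^esub> w) cs"
  shows "chain_labels (tamari_label n s) cs = {a, a'}"
proof -
  interpret lattice L unfolding L_def by (rule lattice_s_tamari)
  interpret two_ascents n s "F u" a b a' b' by (rule tw)
  have vw: "v \<in> carrier L" "w \<in> carrier L" using v w by (simp_all add: L_def)
  define j where "j = v \<squnion>\<^bsub>L\<^esub> w"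
  obtain k where k: "s_tamari_tree n s k" "F k = J"
    using inv_fun_surj[OF J] unfolding F_def .
  have jc: "j \<in> carrier L" using vw by (simp add: j_def)
  have "j \<sqsubseteq>\<^bsub>L\<^esub> k"
    unfolding j_def
  proof (rule join_le)
    show "v \<sqsubseteq>\<^bsub>L\<^esub> k" "w \<sqsubseteq>\<^bsub>L\<^esub> k"
      using g_le_J rot2_le_J
      by (simp_all add: L_def F_def[symmetric] k(2) Fv Fw g_def[symmetric])
  qed (use vw k in \<open>simp_all add: L_def\<close>)
  then have jJ: "F j y x \<le> J y x" for y x using k by (simp add: L_def F_def)
  have "v \<sqsubseteq>\<^bsub>L\<^esub> j" "w \<sqsubseteq>\<^bsub>L\<^esub> j"
    using join_left join_right vw by (simp_all add: j_def)
  then have vj: "F v y x \<le> F j y x" and wj: "F w y x \<le> F j y x" for y x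
    by (simp_all add: L_def F_def)
  define m where "m = length cs - 1"
  have cs: "cs ! 0 = u" "cs ! m = j" and m: "\<And>i. Suc i < length cs \<longleftrightarrow> i < m"
    and cov: "\<And>i. i < m \<Longrightarrow> covers L (cs ! i) (cs ! Suc i)"
    using chain by (auto simp: saturated_chain_def j_def m_def hd_conv_nth last_conv_nth)
  have mono: "F (cs ! i) y x \<le> F (cs ! l) y x" if "i \<le> l" "l \<le> m" for i l y x
    using that
  proof (induction l rule: dec_induct)
    case (step l)
    have "F (cs ! l) y x \<le> F (cs ! Suc l) y x"
      using cov[of l] step.prems by (simp add: covers_def L_def F_def lless_s_tamari)
    with step show ?case by simp
  qed simp
  \<comment> \<open>Each cover of the chain is a rotation meeting the assumptions of the lemmas on a
    chain member, with \<open>p = F (cs ! i)\<close>.\<close>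
  have step: "\<exists>c d. tamari_function n s (F (cs ! i)) \<and> (\<forall>y x. F u y x \<le> F (cs ! i) y x) \<and>
      ascent n s (F (cs ! i)) c d \<and> (\<forall>y x. rot (F (cs ! i)) c d y x \<le> J y x) \<and>
      F (cs ! Suc i) = rot (F (cs ! i)) c d \<and> tamari_label n s (cs ! i) (cs ! Suc i) = c"
    if i: "i < m" for i
  proof -
    obtain c d where cd: "s_tamari_tree n s (cs ! i)" "ascent n s (F (cs ! i)) c d"
      "F (cs ! Suc i) = rot (F (cs ! i)) c d" "tamari_label n s (cs ! i) (cs ! Suc i) = c"
      unfolding F_def by (rule covers_s_tamari[OF cov[OF i, unfolded L_def]])
    moreover have "rot (F (cs ! i)) c d y x \<le> J y x" for y x
      using mono[of "Suc i" m y x] i cs jJ[of y x] cd(3) by simp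
    moreover have "F u y x \<le> F (cs ! i) y x" for y x
      using mono[of 0 i y x] i cs by simp
    moreover have "tamari_function n s (F (cs ! i))"
      unfolding F_def using cd(1) by (rule tamari_function_inv_fun)
    ultimately show ?thesis by blast
  qed
  have lab: "chain_labels (tamari_label n s) cs =
      (\<lambda>i. tamari_label n s (cs ! i) (cs ! Suc i)) ` {..<m}"
    by (auto simp: chain_labels_def m)
  have "tamari_label n s (cs ! i) (cs ! Suc i) \<in> {a, a'}" if i: "i < m" for i
  proof -
    obtain c d where cd: "tamari_function n s (F (cs ! i))" "\<And>y x. F u y x \<le> F (cs ! i) y x"
      "ascent n s (F (cs ! i)) c d" "\<And>y x. rot (F (cs ! i)) c d y x \<le> J y x"
      "tamari_label n s (cs ! i) (cs ! Suc i) = c"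
      using step[OF i] by blast
    with label_cases[OF cd(1-4)] show ?thesis by simp
  qed
  moreover have "\<exists>i<m. tamari_label n s (cs ! i) (cs ! Suc i) = a"
  proof -
    have "F u b a < F j b a"
      using vj[of b a] by (simp add: Fv rot_def block_def)
    then obtain i where i: "i < m" "F (cs ! i) b a < F (cs ! Suc i) b a"
      using step_increase[of "\<lambda>i. F (cs ! i) b a" m] cs by auto
    obtain c d where cd: "tamari_function n s (F (cs ! i))" "\<And>y x. F u y x \<le> F (cs ! i) y x"
      "ascent n s (F (cs ! i)) c d" "\<And>y x. rot (F (cs ! i)) c d y x \<le> J y x"
      "F (cs ! Suc i) = rot (F (cs ! i)) c d" "tamari_label n s (cs ! i) (cs ! Suc i) = c"
      using step[OF i(1)] by blast
    have "c = a" using i(2) unfolding cd(5) by (rule label_of_first[OF cd(1-4)])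
    with i(1) cd(6) show ?thesis by blast
  qed
  moreover have "\<exists>i<m. tamari_label n s (cs ! i) (cs ! Suc i) = a'"
  proof -
    have "F u b' a' < F j b' a'"
      using wj[of b' a'] by (simp add: Fw rot_def block_def)
    then obtain i where i: "i < m" "F (cs ! i) b' a' < F (cs ! Suc i) b' a'"
      using step_increase[of "\<lambda>i. F (cs ! i) b' a'" m] cs by auto
    obtain c d where cd: "tamari_function n s (F (cs ! i))" "\<And>y x. F u y x \<le> F (cs ! i) y x"
      "ascent n s (F (cs ! i)) c d" "\<And>y x. rot (F (cs ! i)) c d y x \<le> J y x"
      "F (cs ! Suc i) = rot (F (cs ! i)) c d" "tamari_label n s (cs ! i) (cs ! Suc i) = c"
      using step[OF i(1)] by blast
    have "c = a'" using i(2) unfolding cd(5) by (rule label_of_second[OF cd(1-4)])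
    with i(1) cd(6) show ?thesis by blast
  qed
  ultimately show ?thesis unfolding lab by auto
qed

theorem theorem4p13:
  fixes n :: nat and s :: "nat \<Rightarrow> nat"
  shows "SB_labeling (s_tamari n s) (tamari_label n s)"
proof -
  let ?L = "s_tamari n s" and ?F = "inv_fun n s" and ?lam = "tamari_label n s"
  have key: "?lam u v \<noteq> ?lam u w \<and>
      (\<forall>cs. saturated_chain ?L u (v \<squnion>\<^bsub>?L\<^esub> w) cs \<longrightarrow> chain_labels ?lam cs = {?lam u v, ?lam u w})"
    if uv: "covers ?L u v" and uw: "covers ?L u w" and vw: "v \<noteq> w" for u v w
  proof -
    obtain a b where v: "s_tamari_tree n s u" "s_tamari_tree n s v"
      "ascent n s (?F u) a b" "?F v = rot (?F u) a b" "?lam u v = a"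
      using covers_s_tamari[OF uv] .
    obtain a' b' where w: "s_tamari_tree n s w"
      "ascent n s (?F u) a' b'" "?F w = rot (?F u) a' b'" "?lam u w = a'"
      using covers_s_tamari[OF uw] .
    note f = tamari_function_inv_fun[OF v(1)]
    have "(a, b) \<noteq> (a', b')" using v w vw inv_fun_inject[of n s v w] by auto
    \<comment> \<open>Distinct covers come from distinct ascents, so one of them is
      lexicographically first; in the second case \<open>v\<close> and \<open>w\<close> exchange
      roles.\<close>
    then consider "b < b' \<or> b = b' \<and> a < a'" | "b' < b \<or> b' = b \<and> a' < a" by fastforce
    then show ?thesis
    proof cases
      case 1
      then interpret two_ascents n s "?F u" a b a' b'
        using f v w by unfold_locales
      show ?thesis
        using neq chain_labels_two_ascents[OF v(1,2) w(1) two_ascents_axioms v(4) w(3)] v(5) w(4)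
        by simp
    next
      case 2
      then interpret two_ascents n s "?F u" a' b' a b
        using f v w by unfold_locales
      have "v \<squnion>\<^bsub>?L\<^esub> w = w \<squnion>\<^bsub>?L\<^esub> v" by (simp add: join_def insert_commute)
      then show ?thesis
        using neq chain_labels_two_ascents[OF v(1) w(1) v(2) two_ascents_axioms w(3) v(4)] v(5) w(4)
        by auto
    qed
  qed
  show ?thesis
    unfolding SB_labeling_def
  proof (intro conjI allI impI finite_s_tamari lattice_s_tamari)
    fix u v w assume "covers ?L u v \<and> covers ?L u w \<and> v \<noteq> w"
    then have "covers ?L u v" "covers ?L u w" "v \<noteq> w" by simp_all
    note k = key[OF this]
    show "?lam u v \<noteq> ?lam u w" using k ..
    have *: "chain_labels ?lam cs = {?lam u v, ?lam u w}"
      if "saturated_chain ?L u (v \<squnion>\<^bsub>?L\<^esub> w) cs" for cs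
      using k that by blast
    show "?lam u v \<in> chain_labels ?lam cs" "?lam u w \<in> chain_labels ?lam cs"
      "chain_labels ?lam cs \<subseteq> {?lam u v, ?lam u w}"
      if "saturated_chain ?L u (v \<squnion>\<^bsub>?L\<^esub> w) cs" for cs
      using *[OF that] by simp_all
  qed
qed

end
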